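(* Let $F$ be a forest. Then $AR_d(F) = e(F) - 1$, unless $F$ is a star (of any size) or a matching with precisely two edges, in which case $AR_d(F) = e(F)$.
   Context: All graphs are finite and simple; $e(F)$ denotes the number of edges of $F$. A proper edge colouring assigns colours to edges so that edges sharing a vertex receive distinct colours. A copy of $F$ in an edge-coloured graph is rainbow if all its edges have distinct colours. The degree anti-Ramsey number $AR_d(F)$ is the smallest integer $k$ for which there exists a graph $G$ with maximum degree at most $k$ such that every proper edge colouring of $G$ contains a rainbow copy of $F$. A star is a graph $K_{1,t}$ for some $t\ge 1$.
   Formalization: "Star" and "matching with two edges" are read up to isolated vertices (an edge plus an isolated vertex has AR_d = 1, not e(F) − 1 = 0), and for a forest without edges the value is 0 instead of e(F) − 1 = −1. *)

theory Defs
  imports Main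
begin

type_synonym 'a ugraph = "'a set \<times> 'a set set"

abbreviation verts :: "'a ugraph \<Rightarrow> 'a set" where
  "verts \<equiv> fst"

abbreviation edges :: "'a ugraph \<Rightarrow> 'a set set" where
  "edges \<equiv> snd"

definition simple_graph :: "'a ugraph \<Rightarrow> bool" where
  "simple_graph G \<longleftrightarrow> finite (verts G) \<and> (\<forall>e\<in>edges G. e \<subseteq> verts G \<and> card e = 2)"

definition num_edges :: "'a ugraph \<Rightarrow> nat" where
  "num_edges G = card (edges G)"

definition degree :: "'a ugraph \<Rightarrow> 'a \<Rightarrow> nat" where
  "degree G v = card {e \<in> edges G. v \<in> e}"

definition max_degree_le :: "'a ugraph \<Rightarrow> nat \<Rightarrow> bool" where
  "max_degree_le G k \<longleftrightarrow> (\<forall>v\<in>verts G. degree G v \<le> k)"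

definition subgraph :: "'a ugraph \<Rightarrow> 'a ugraph \<Rightarrow> bool" where
  "subgraph H G \<longleftrightarrow> simple_graph H \<and> verts H \<subseteq> verts G \<and> edges H \<subseteq> edges G"

definition isomorphic :: "'a ugraph \<Rightarrow> 'b ugraph \<Rightarrow> bool" where
  "isomorphic F H \<longleftrightarrow>
     (\<exists>f. bij_betw f (verts F) (verts H) \<and> edges H = (\<lambda>e. f ` e) ` edges F)"

definition proper_edge_colouring :: "'a ugraph \<Rightarrow> ('a set \<Rightarrow> 'c) \<Rightarrow> bool" where
  "proper_edge_colouring G c \<longleftrightarrow>
     (\<forall>e\<in>edges G. \<forall>f\<in>edges G. e \<noteq> f \<and> e \<inter> f \<noteq> {} \<longrightarrow> c e \<noteq> c f)"

definition rainbow :: "('a set \<Rightarrow> 'c) \<Rightarrow> 'a ugraph \<Rightarrow> bool" where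
  "rainbow c H \<longleftrightarrow> inj_on c (edges H)"

definition has_rainbow_copy :: "'a ugraph \<Rightarrow> 'b ugraph \<Rightarrow> ('b set \<Rightarrow> 'c) \<Rightarrow> bool" where
  "has_rainbow_copy F G c \<longleftrightarrow> (\<exists>H. subgraph H G \<and> isomorphic F H \<and> rainbow c H)"

text \<open>Every finite graph is isomorphic to one with vertices in \<^typ>\<open>nat\<close>, and a colouring of
  finitely many edges uses only finitely many colours, so \<^typ>\<open>nat\<close> suffices both for the vertices
  of the host graph and for the colours.\<close>

definition AR_d :: "'a ugraph \<Rightarrow> nat" where
  "AR_d F = (LEAST k. \<exists>G :: nat ugraph. simple_graph G \<and> max_degree_le G k \<and>
     (\<forall>c :: nat set \<Rightarrow> nat. proper_edge_colouring G c \<longrightarrow> has_rainbow_copy F G c))"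

definition is_cycle :: "'a ugraph \<Rightarrow> 'a list \<Rightarrow> bool" where
  "is_cycle G vs \<longleftrightarrow> 3 \<le> length vs \<and> distinct vs \<and>
     (\<forall>i < length vs. {vs ! i, vs ! (Suc i mod length vs)} \<in> edges G)"

definition forest :: "'a ugraph \<Rightarrow> bool" where
  "forest G \<longleftrightarrow> simple_graph G \<and> (\<nexists>vs. is_cycle G vs)"

definition is_star :: "'a ugraph \<Rightarrow> bool" where
  "is_star G \<longleftrightarrow> (\<exists>z L. finite L \<and> L \<noteq> {} \<and> z \<notin> L \<and>
     verts G = insert z L \<and> edges G = (\<lambda>x. {z, x}) ` L)"

definition is_matching :: "'a ugraph \<Rightarrow> bool" where
  "is_matching G \<longleftrightarrow> (\<forall>e\<in>edges G. \<forall>f\<in>edges G. e \<noteq> f \<longrightarrow> e \<inter> f = {})"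

text \<open>Isolated vertices change neither the number of edges nor the degree anti-Ramsey number, so
  the exceptional cases have to be read up to isolated vertices: a star together with an isolated
  vertex is still exceptional. For matchings this is built into \<^const>\<open>is_matching\<close>; for stars,
  isolated vertices are deleted first.\<close>

definition delete_isolated :: "'a ugraph \<Rightarrow> 'a ugraph" where
  "delete_isolated G = ({v \<in> verts G. \<exists>e\<in>edges G. v \<in> e}, edges G)"

end

theory Submission
  imports Defs "HOL-Combinatorics.Permutations"
begin

text \<open>
  Write \<open>d = e(F) - 1\<close>. The lower bound \<open>AR_d(F) \<ge> d\<close> is Vizing's theorem: a graph of maximum degree
  \<open>k < d\<close> has a proper edge colouring with \<open>k + 1 < e(F)\<close> colours.

  For the upper bound the host consists of disjoint copies of a \<open>d\<close>-regular graph of large girth that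
  is not \<open>d\<close>-edge-colourable. Every vertex sees \<open>d\<close> colours, so all edges of \<open>F\<close> but the last can be
  embedded greedily, each with a colour not used before; large girth makes the result injective. For
  the last edge, a leaf edge \<open>yz\<close>, one first uses a colour that does not occur at the image of \<open>y\<close>:
  such a colour exists next to that image because in a graph that is not \<open>d\<close>-edge-colourable two
  adjacent vertices see different colour sets, and \<open>F\<close> has an edge avoiding \<open>y\<close> because it is not a star.

  Large girth is used only in the form that every nonempty set \<open>C\<close> of few edges spans more than \<open>|C|\<close>
  vertices.
\<close>

section \<open>Sparse edge sets and connectivity\<close>

text \<open>With \<open>d\<close> edges embedded, their colours may be exactly the \<open>d\<close>
  colours at the image of \<open>y\<close>, so plain greed can fail at the last edge; it suffices
  that one used colour is absent there. If an edge \<open>xw\<close> avoiding \<open>y\<close> has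
  \<open>x\<close> adjacent to \<open>y\<close>, then \<open>y\<close> and \<open>x\<close> go to
  adjacent host vertices with different colour sets. Otherwise the component of \<open>y\<close> is
  a star centred at \<open>y\<close>, an edge avoiding \<open>y\<close> lies in another component of
  the forest, and it is placed in another copy of the host. This is one reason for taking a copy for
  each component; the other is that sparsity separates vertices only within a component. The
  exceptions mark where this breaks: in a star no edge avoids \<open>y\<close>, and for two disjoint
  edges \<open>d = 1\<close>, where a regular host is a matching and hence
  \<open>1\<close>-edge-colourable. Colourings may use any number of colours, so the obstruction is
  needed in the form that some edge joins vertices with different colour sets; the host enforces
  this by parity.\<close>

definition sparse :: "nat \<Rightarrow> 'a set set \<Rightarrow> bool" where
  "sparse L E \<longleftrightarrow> (\<forall>C\<subseteq>E. finite C \<and> C \<noteq> {} \<and> card C \<le> L \<longrightarrow> card C < card (\<Union>C))"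

lemma sum_card_incident:
  assumes "finite B" "finite W"
  shows "(\<Sum>q\<in>W. card {e\<in>B. q \<in> e}) = (\<Sum>e\<in>B. card (e \<inter> W))"
proof -
  have "(\<Sum>q\<in>W. card {e\<in>B. q \<in> e}) = (\<Sum>q\<in>W. \<Sum>e\<in>B. if q \<in> e then 1 else 0)"
    using assms by (simp add: sum.If_cases Int_def)
  also have "\<dots> = (\<Sum>e\<in>B. \<Sum>q\<in>W. if q \<in> e then 1 else 0)"
    by (rule sum.swap)
  also have "\<dots> = (\<Sum>e\<in>B. card (e \<inter> W))"
    using assms by (simp add: sum.If_cases Int_def conj_commute)
  finally show ?thesis .
qed

lemma card2_other:
  assumes "card e = 2" "v \<in> e"
  obtains w where "e = {v, w}" "w \<noteq> v"
  using assms by (metis card_2_iff doubleton_eq_iff insertE singletonD)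

lemma finite_Union_card2:
  assumes "finite E" "\<And>e. e \<in> E \<Longrightarrow> card e = 2"
  shows "finite (\<Union>E)"
proof (rule finite_Union)
  show "finite e" if "e \<in> E" for e using assms(2)[OF that] by (simp add: card_ge_0_finite)
qed (rule assms)

text \<open>In a longest path, a second edge at the head must return to the path by maximality; the
  initial segment up to the point of return is the cycle.\<close>

lemma min_degree_two_imp_cycle:
  assumes fin: "finite C" and two: "\<And>e. e \<in> C \<Longrightarrow> card e = 2" and ne: "C \<noteq> {}"
    and deg: "\<And>v e. e \<in> C \<Longrightarrow> v \<in> e \<Longrightarrow> \<exists>f\<in>C. v \<in> f \<and> f \<noteq> e"
  shows "\<exists>vs. is_cycle (V, C) vs \<and> set vs \<subseteq> \<Union>C"
proof -
  define P where "P vs \<longleftrightarrow> distinct vs \<and> set vs \<subseteq> \<Union>C \<and> successively (\<lambda>a b. {a,b} \<in> C) vs \<and> 2 \<le> length vs" for vs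
  have finU: "finite (\<Union>C)"
    using fin two by (rule finite_Union_card2)
  obtain e where e: "e \<in> C" using ne by blast
  then obtain a b where ab: "e = {a,b}" "a \<noteq> b" using two by (meson card_2_iff)
  have "P [a,b]" using e ab by (auto simp: P_def)
  moreover have "length vs < Suc (card (\<Union>C))" if "P vs" for vs
    using that finU unfolding P_def by (metis card_mono distinct_card less_Suc_eq_le)
  ultimately obtain vs where vs: "P vs" and max: "\<And>ws. P ws \<Longrightarrow> length ws \<le> length vs"
    using ex_has_greatest_nat[of P "[a,b]" length "Suc (card (\<Union>C))"] by (metis less_imp_le)
  obtain h h2 t where hs: "vs = h # h2 # t"
    using vs unfolding P_def by (metis One_nat_def Suc_1 Suc_le_length_iff)
  have "{h,h2} \<in> C" using vs hs by (auto simp: P_def)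
  then obtain f where f: "f \<in> C" "h \<in> f" "f \<noteq> {h,h2}" using deg by blast
  then obtain u where u: "f = {h,u}" "u \<noteq> h" using two card2_other by metis
  have "u \<in> set vs"
  proof (rule ccontr)
    assume "u \<notin> set vs"
    then have "P (u # vs)"
      using vs f u hs by (auto simp: P_def insert_commute)
    then show False using max by fastforce
  qed
  then obtain j where j: "j < length vs" "vs ! j = u" by (auto simp: in_set_conv_nth)
  have j2: "2 \<le> j"
    using j hs u f by (cases j; cases "j - 1") auto
  let ?c = "take (Suc j) vs"
  have len: "length ?c = Suc j" using j by simp
  have "{?c ! i, ?c ! (Suc i mod length ?c)} \<in> C" if "i < length ?c" for i
  proof (cases "i = j")
    case True
    have "{u, h} \<in> C" using f u by (simp add: insert_commute)
    moreover have "?c ! 0 = h" using hs by simp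
    moreover have "?c ! i = u" using True j by simp
    ultimately show ?thesis using True len by simp
  next
    case False
    then have "i < j" using that len by simp
    then have "{vs ! i, vs ! Suc i} \<in> C"
      using vs j successively_nth unfolding P_def by fastforce
    then show ?thesis using \<open>i < j\<close> len by simp
  qed
  moreover have "distinct ?c" "set ?c \<subseteq> \<Union>C"
    using vs set_take_subset[of "Suc j" vs] unfolding P_def by auto
  ultimately show ?thesis
    using len j2 unfolding is_cycle_def by (intro exI[of _ ?c]) auto
qed

text \<open>Deleting an edge with an end of degree one costs one edge and at least one vertex, so
  induction applies; without such an edge \<open>C\<close> contains a cycle, which alone has more
  than \<open>L\<close> vertices. For two-element edges \<open>sparse L\<close> amounts to girth
  above \<open>L\<close>, in a form in which later arguments only add and compare
  cardinalities.\<close>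

lemma sparse_if_no_short_cycle:
  assumes two: "\<And>e. e \<in> E \<Longrightarrow> card e = 2"
    and cyc: "\<And>vs. is_cycle (V, E) vs \<Longrightarrow> L < length vs"
  shows "sparse L E"
proof -
  have "card C < card (\<Union>C)" if "finite C" "C \<subseteq> E" "C \<noteq> {}" "card C \<le> L" for C
    using that
  proof (induction "card C" arbitrary: C rule: less_induct)
    case less
    have two': "\<And>e. e \<in> C \<Longrightarrow> card e = 2" using less.prems two by blast
    have finU: "finite (\<Union>C)"
      using less.prems(1) two' by (rule finite_Union_card2)
    show ?case
    proof (cases "\<exists>v e. e \<in> C \<and> v \<in> e \<and> (\<forall>f\<in>C. v \<in> f \<longrightarrow> f = e)")
      case True
      then obtain v e where ve: "e \<in> C" "v \<in> e" "\<And>f. f \<in> C \<Longrightarrow> v \<in> f \<Longrightarrow> f = e" by blast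
      show ?thesis
      proof (cases "C = {e}")
        case True then show ?thesis using two'[OF ve(1)] by simp
      next
        case False
        have lt: "card (C - {e}) < card C" using ve less.prems by (meson card_Diff1_less)
        have "card (C - {e}) < card (\<Union>(C - {e}))"
        proof (rule less.hyps[OF lt])
          show "finite (C - {e})" using less.prems by simp
          show "C - {e} \<subseteq> E" using less.prems by blast
          show "C - {e} \<noteq> {}" using False ve by blast
          show "card (C - {e}) \<le> L" using lt less.prems by linarith
        qed
        moreover have "\<Union>(C - {e}) \<subset> \<Union>C" using ve by blast
        then have "card (\<Union>(C - {e})) < card (\<Union>C)" using finU by (simp add: psubset_card_mono)
        moreover have "card C = Suc (card (C - {e}))"
          using ve less.prems by (meson card.remove)
        ultimately show ?thesis by linarith
      qed
    next
      case False
      then obtain vs where vs: "is_cycle (V, C) vs" "set vs \<subseteq> \<Union>C"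
        using min_degree_two_imp_cycle[of C V] less.prems two' by metis
      then have "is_cycle (V, E) vs" using less.prems unfolding is_cycle_def by auto
      then have "L < length vs" by (rule cyc)
      also have "length vs = card (set vs)" using vs distinct_card unfolding is_cycle_def by metis
      also have "\<dots> \<le> card (\<Union>C)" using vs finU by (simp add: card_mono)
      finally show ?thesis using less.prems by linarith
    qed
  qed
  then show ?thesis unfolding sparse_def by blast
qed

section \<open>Components and their edge counts\<close>

definition reach :: "'a set set \<Rightarrow> 'a \<Rightarrow> 'a set" where
  "reach E v = {w. (v, w) \<in> {(a, b). {a, b} \<in> E}\<^sup>*}"

lemma reach_refl: "v \<in> reach E v"
  by (simp add: reach_def)

lemma reach_step: "a \<in> reach E v \<Longrightarrow> {a, b} \<in> E \<Longrightarrow> b \<in> reach E v"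
  unfolding reach_def by (auto intro: rtrancl_into_rtrancl)

lemma reach_sym: "w \<in> reach E v \<Longrightarrow> v \<in> reach E w"
proof -
  have "sym ({(a, b). {a, b} \<in> E}\<^sup>*)"
    by (intro sym_rtrancl symI) (simp add: insert_commute)
  then show "w \<in> reach E v \<Longrightarrow> v \<in> reach E w"
    unfolding reach_def by (auto dest: symD)
qed

lemma reach_trans: "w \<in> reach E v \<Longrightarrow> z \<in> reach E w \<Longrightarrow> z \<in> reach E v"
  unfolding reach_def by auto

lemma reach_eq: "w \<in> reach E v \<Longrightarrow> reach E w = reach E v"
  using reach_trans[of w E v] reach_trans[of v E w] reach_sym[of w E v] by auto

lemma reach_edge_eq: "{a, b} \<in> E \<Longrightarrow> reach E a = reach E b"
  using reach_eq reach_refl reach_step by metis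

lemma reach_induct [consumes 1, case_names refl step]:
  assumes "w \<in> reach E v" "P v" "\<And>a b. a \<in> reach E v \<Longrightarrow> P a \<Longrightarrow> {a, b} \<in> E \<Longrightarrow> P b"
  shows "P w"
proof -
  have "(v, w) \<in> {(a, b). {a, b} \<in> E}\<^sup>*" using assms(1) by (simp add: reach_def)
  then show ?thesis
  proof (induction rule: rtrancl_induct)
    case base show ?case by (rule assms(2))
  next
    case (step a b)
    then show ?case using assms(3)[of a b] by (simp add: reach_def)
  qed
qed

lemma reach_subset: "reach E v \<subseteq> insert v (\<Union>E)"
proof
  fix w assume "w \<in> reach E v"
  then show "w \<in> insert v (\<Union>E)" by (induction rule: reach_induct) auto
qed

lemma finite_reach:
  assumes "finite E" "\<And>e. e \<in> E \<Longrightarrow> card e = 2"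
  shows "finite (reach E v)"
proof -
  have "finite (\<Union>E)" using assms by (rule finite_Union_card2)
  then show ?thesis using reach_subset by (meson finite_insert finite_subset)
qed

text \<open>A largest part of the component that contains \<open>v\<close> and satisfies the bound
  is the whole component: an edge leaving it would bring one new vertex and at least one new
  edge.\<close>

lemma card_reach_le:
  assumes fin: "finite E" and two: "\<And>e. e \<in> E \<Longrightarrow> card e = 2"
  shows "card (reach E v) \<le> Suc (card {e\<in>E. e \<subseteq> reach E v})"
proof -
  define P where "P A \<longleftrightarrow> v \<in> A \<and> A \<subseteq> reach E v \<and> card A \<le> Suc (card {e\<in>E. e \<subseteq> A})" for A
  have finK: "finite (reach E v)" using assms by (rule finite_reach)
  have "P {v}" by (simp add: P_def reach_refl)
  moreover have "card A \<le> card (reach E v)" if "P A" for A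
    using that finK unfolding P_def by (simp add: card_mono)
  ultimately obtain A where A: "P A" and max: "\<And>B. P B \<Longrightarrow> card B \<le> card A"
    using ex_has_greatest_nat[of P "{v}" card "Suc (card (reach E v))"]
    by (metis less_Suc_eq_le)
  have finA: "finite A" using A finK finite_subset unfolding P_def by blast
  have "w \<in> A" if "w \<in> reach E v" for w
    using that
  proof (induction rule: reach_induct)
    case refl then show ?case using A by (simp add: P_def)
  next
    case (step a b)
    show ?case
    proof (rule ccontr)
      assume b: "b \<notin> A"
      have "insert {a,b} {e\<in>E. e \<subseteq> A} \<subseteq> {e\<in>E. e \<subseteq> insert b A}" using step by auto
      then have "card (insert {a,b} {e\<in>E. e \<subseteq> A}) \<le> card {e\<in>E. e \<subseteq> insert b A}"
        using fin by (intro card_mono) auto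
      then have "Suc (card {e\<in>E. e \<subseteq> A}) \<le> card {e\<in>E. e \<subseteq> insert b A}"
        using b fin by simp
      then have "P (insert b A)"
        using A b finA step reach_step[of a E v b] by (auto simp: P_def)
      then show False using max[of "insert b A"] b finA by simp
    qed
  qed
  then have "A = reach E v" using A by (auto simp: P_def)
  then show ?thesis using A by (simp add: P_def)
qed

text \<open>The degree sum gives at most \<open>2 * card ?K - 3\<close> for twice the number of
  edges, whereas connectedness needs \<open>card ?K - 1\<close> edges. Applied to the subgraph of
  two colours, this replaces the description of its components as paths and cycles.\<close>

lemma three_ends_not_connected:
  assumes fin: "finite E" and two: "\<forall>e\<in>E. card e = 2"
    and deg: "\<And>v. card {e\<in>E. v \<in> e} \<le> 2"
    and ends: "card {e\<in>E. x \<in> e} \<le> 1" "card {e\<in>E. y \<in> e} \<le> 1" "card {e\<in>E. z \<in> e} \<le> 1"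
    and dist: "x \<noteq> y" "x \<noteq> z" "y \<noteq> z"
    and K: "y \<in> reach E x" "z \<in> reach E x"
  shows False
proof -
  let ?K = "reach E x" and ?B = "{e\<in>E. e \<subseteq> reach E x}"
  have finK: "finite ?K" by (rule finite_reach[OF fin bspec[OF two]])
  let ?d = "\<lambda>q. card {e\<in>?B. q \<in> e}"
  have le: "?d q \<le> card {e\<in>E. q \<in> e}" for q using fin by (intro card_mono) auto
  have "(\<Sum>q\<in>?K. ?d q) = (\<Sum>e\<in>?B. card (e \<inter> ?K))"
    using fin finK by (intro sum_card_incident) auto
  also have "\<dots> = (\<Sum>e\<in>?B. 2)" using two by (intro sum.cong) (auto simp: Int_absorb2)
  finally have s: "(\<Sum>q\<in>?K. ?d q) = 2 * card ?B" by simp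
  have sub: "{x,y,z} \<subseteq> ?K" using K reach_refl by auto
  have "(\<Sum>q\<in>?K. ?d q) = (\<Sum>q\<in>?K - {x,y,z}. ?d q) + (\<Sum>q\<in>{x,y,z}. ?d q)"
    using sub finK by (simp add: sum.subset_diff)
  also have "(\<Sum>q\<in>{x,y,z}. ?d q) \<le> 3"
    using dist ends le[of x] le[of y] le[of z] by simp
  also have "(\<Sum>q\<in>?K - {x,y,z}. ?d q) \<le> card (?K - {x,y,z}) * 2"
    using deg le by (intro sum_bounded_above[where K = "2::nat", simplified]) (meson order_trans)
  finally have "2 * card ?B \<le> card (?K - {x,y,z}) * 2 + 3" using s by simp
  moreover have "card (?K - {x,y,z}) = card ?K - 3"
    using sub dist by (simp add: card_Diff_subset)
  moreover have "3 \<le> card ?K" using card_mono[OF finK sub] dist by simp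
  moreover have "card ?K \<le> Suc (card ?B)" by (rule card_reach_le[OF fin bspec[OF two]])
  ultimately show False by linarith
qed

section \<open>Vizing's theorem\<close>

text \<open>The palette is \<open>0\<close>, ..., \<open>k\<close>, hence \<open>k + 1\<close>
  colours: one more than a degree bound \<open>k\<close>, so that a colour is missing at each
  vertex.\<close>

definition edge_colouring :: "'a set set \<Rightarrow> nat \<Rightarrow> ('a set \<Rightarrow> nat) \<Rightarrow> bool" where
  "edge_colouring E k c \<longleftrightarrow> (\<forall>e\<in>E. c e \<le> k) \<and>
     (\<forall>e\<in>E. \<forall>f\<in>E. e \<noteq> f \<and> e \<inter> f \<noteq> {} \<longrightarrow> c e \<noteq> c f)"

definition missing :: "'a set set \<Rightarrow> nat \<Rightarrow> ('a set \<Rightarrow> nat) \<Rightarrow> 'a \<Rightarrow> nat set" where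
  "missing E k c v = {i. i \<le> k \<and> (\<forall>e\<in>E. v \<in> e \<longrightarrow> c e \<noteq> i)}"

lemma edge_colouring_unique:
  "edge_colouring E k c \<Longrightarrow> e \<in> E \<Longrightarrow> f \<in> E \<Longrightarrow> v \<in> e \<Longrightarrow> v \<in> f \<Longrightarrow> c e = c f \<Longrightarrow> e = f"
  unfolding edge_colouring_def by blast

lemma missing_nonempty:
  assumes "finite E" "card {e\<in>E. v \<in> e} \<le> k"
  shows "missing E k c v \<noteq> {}"
proof
  assume "missing E k c v = {}"
  then have "{..k} \<subseteq> c ` {e\<in>E. v \<in> e}" unfolding missing_def by auto
  then have "card {..k} \<le> card (c ` {e\<in>E. v \<in> e})" using assms by (intro card_mono) auto
  also have "\<dots> \<le> card {e\<in>E. v \<in> e}" using assms by (intro card_image_le) auto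
  finally show False using assms by simp
qed

text \<open>An uncoloured edge is modelled by deleting it from \<open>E\<close>, so \<open>c\<close>
  may take any value there. Giving \<open>{x, y}\<close> the colour of the next spoke moves the
  uncoloured edge one step along the fan, until it reaches the last spoke, where \<open>g\<close> is
  free at both ends.\<close>

lemma fan_shift:
  assumes two: "\<forall>e\<in>E. card e = 2"
  shows "distinct (y # ys) \<Longrightarrow> (\<forall>z\<in>set (y # ys). {x, z} \<in> E) \<Longrightarrow>
    edge_colouring (E - {{x, y}}) k c \<Longrightarrow>
    successively (\<lambda>a b. c {x, b} \<in> missing (E - {{x, y}}) k c a) (y # ys) \<Longrightarrow>
    g \<in> missing (E - {{x, y}}) k c x \<Longrightarrow> g \<in> missing (E - {{x, y}}) k c (last (y # ys)) \<Longrightarrow>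
    \<exists>c'. edge_colouring E k c'"
proof (induction ys arbitrary: y c)
  case Nil
  let ?c = "c({x,y} := g)"
  have g: "g \<le> k" "\<And>e. e \<in> E \<Longrightarrow> e \<noteq> {x,y} \<Longrightarrow> x \<in> e \<or> y \<in> e \<Longrightarrow> c e \<noteq> g"
    using Nil.prems(5,6) by (auto simp: missing_def)
  have "edge_colouring E k ?c"
    unfolding edge_colouring_def
  proof (intro conjI ballI impI)
    fix e assume "e \<in> E" then show "?c e \<le> k"
      using Nil.prems(3) g by (auto simp: edge_colouring_def)
  next
    fix e f assume "e \<in> E" "f \<in> E" and *: "e \<noteq> f \<and> e \<inter> f \<noteq> {}"
    then show "?c e \<noteq> ?c f"
      using Nil.prems(3) g(2)[of e] g(2)[of f]
      by (cases "e = {x,y}"; cases "f = {x,y}") (auto simp: edge_colouring_def)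
  qed
  then show ?case by blast
next
  case (Cons z zs)
  let ?c = "c({x,y} := c {x,z})"
  have xE: "{x,y} \<in> E" "{x,z} \<in> E" using Cons.prems(2) by auto
  have neq: "x \<noteq> y" "x \<noteq> z" "y \<noteq> z" using bspec[OF two xE(1)] bspec[OF two xE(2)] Cons.prems(1) by auto
  have xne: "x \<noteq> w" if "w \<in> set (z # zs)" for w
    using bspec[OF two, of "{x,w}"] Cons.prems(2) that by auto
  have xyz: "{x,y} \<noteq> {x,z}" using neq by (auto simp: doubleton_eq_iff)
  have cz: "c {x,z} \<in> missing (E - {{x,y}}) k c y" using Cons.prems(4) by simp
  have col: "edge_colouring (E - {{x,z}}) k ?c"
    unfolding edge_colouring_def
  proof (intro conjI ballI impI)
    fix e assume "e \<in> E - {{x,z}}" then show "?c e \<le> k"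
      using Cons.prems(3) cz by (auto simp: edge_colouring_def missing_def)
  next
    have h: "c e \<noteq> c {x,z}" if "e \<in> E - {{x,z}}" "e \<noteq> {x,y}" "x \<in> e \<or> y \<in> e" for e
    proof (cases "x \<in> e")
      case True
      then show ?thesis
        using edge_colouring_unique[OF Cons.prems(3), of e "{x,z}" x] that xE xyz by auto
    next
      case False
      then show ?thesis using cz that by (auto simp: missing_def)
    qed
    fix e f assume ef: "e \<in> E - {{x,z}}" "f \<in> E - {{x,z}}" and *: "e \<noteq> f \<and> e \<inter> f \<noteq> {}"
    then show "?c e \<noteq> ?c f"
      using Cons.prems(3) h[of e] h[of f]
      by (cases "e = {x,y}"; cases "f = {x,y}") (auto simp: edge_colouring_def)
  qed
  have miss: "missing (E - {{x,y}}) k c w \<subseteq> missing (E - {{x,z}}) k ?c w"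
    if "w \<noteq> x" "w \<noteq> y" for w
    using that by (auto simp: missing_def)
  have ceq: "?c {x,b} = c {x,b}" if "b \<noteq> y" for b
    using that by (auto simp: doubleton_eq_iff)
  have fan: "successively (\<lambda>a b. ?c {x, b} \<in> missing (E - {{x, z}}) k ?c a) (z # zs)"
  proof (rule successively_mono)
    show "successively (\<lambda>a b. c {x, b} \<in> missing (E - {{x, y}}) k c a) (z # zs)"
      using Cons.prems(4) by simp
  next
    fix a b assume ab: "a \<in> set (z # zs)" "b \<in> set (z # zs)"
      and m: "c {x, b} \<in> missing (E - {{x, y}}) k c a"
    have "a \<noteq> y" "b \<noteq> y" using ab Cons.prems(1) by auto
    then show "?c {x, b} \<in> missing (E - {{x, z}}) k ?c a"
      using miss[of a] m ceq[of b] xne[OF ab(1)] by auto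
  qed
  have "g \<noteq> c {x,z}" using Cons.prems(5) xE xyz by (auto simp: missing_def)
  then have gx: "g \<in> missing (E - {{x, z}}) k ?c x"
    using Cons.prems(5) by (auto simp: missing_def)
  have l: "last (z # zs) \<in> set (z # zs)" by (rule last_in_set) simp
  have "last (z # zs) \<noteq> y" using l Cons.prems(1) by (metis distinct.simps(2))
  then have gl: "g \<in> missing (E - {{x, z}}) k ?c (last (z # zs))"
    using Cons.prems(6) miss[of "last (z # zs)"] xne[OF l] by auto
  show ?case
    by (rule Cons.IH[of z ?c, OF _ _ col fan gx gl]) (use Cons.prems in auto)
qed

text \<open>Edges that meet \<open>K\<close> in one end only are transposed as well. When
  \<open>K\<close> is a component of the subgraph of the two colours, such edges have neither colour
  and keep their own.\<close>

definition kempe_swap :: "nat \<Rightarrow> nat \<Rightarrow> 'a set \<Rightarrow> ('a set \<Rightarrow> nat) \<Rightarrow> 'a set \<Rightarrow> nat" where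
  "kempe_swap a b K c e = (if e \<inter> K \<noteq> {} then transpose a b (c e) else c e)"

context
  fixes E :: "'a set set" and k a b c K q
  assumes two: "\<forall>e\<in>E. card e = 2"
    and col: "edge_colouring E k c" and ab: "a \<le> k" "b \<le> k"
    and K: "K = reach {e\<in>E. c e = a \<or> c e = b} q"
begin

lemma kempe_swap_outside:
  assumes "e \<in> E" "v \<in> e" "v \<notin> K"
  shows "kempe_swap a b K c e = c e"
proof (cases "c e = a \<or> c e = b")
  case True
  have "e \<inter> K = {}"
  proof (rule ccontr)
    assume "e \<inter> K \<noteq> {}"
    then obtain w where w: "w \<in> e" "w \<in> K" by blast
    then have "e = {w, v}" using card2_other[OF bspec[OF two assms(1)] w(1)] assms by blast
    then have "v \<in> K" using K w reach_step[of w _ q v] True assms by auto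
    then show False using assms by blast
  qed
  then show ?thesis by (simp add: kempe_swap_def)
next
  case False
  then show ?thesis by (auto simp: kempe_swap_def transpose_def)
qed

lemma kempe_swap_inside: "v \<in> e \<Longrightarrow> v \<in> K \<Longrightarrow> kempe_swap a b K c e = transpose a b (c e)"
  by (auto simp: kempe_swap_def)

lemma edge_colouring_kempe_swap: "edge_colouring E k (kempe_swap a b K c)"
  unfolding edge_colouring_def
proof (intro conjI ballI impI)
  fix e assume "e \<in> E"
  then show "kempe_swap a b K c e \<le> k"
    using col ab by (auto simp: kempe_swap_def edge_colouring_def transpose_def)
next
  fix e f assume e: "e \<in> E" and f: "f \<in> E" and *: "e \<noteq> f \<and> e \<inter> f \<noteq> {}"
  then obtain v where v: "v \<in> e" "v \<in> f" by blast
  have "c e \<noteq> c f" using col e f * by (auto simp: edge_colouring_def)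
  then have "transpose a b (c e) \<noteq> transpose a b (c f)" by (metis transpose_involutory)
  with \<open>c e \<noteq> c f\<close> show "kempe_swap a b K c e \<noteq> kempe_swap a b K c f"
    using kempe_swap_outside[OF e v(1)] kempe_swap_outside[OF f v(2)]
      kempe_swap_inside[OF v(1)] kempe_swap_inside[OF v(2)]
    by (cases "v \<in> K") auto
qed

lemma missing_kempe_swap:
  "missing E k (kempe_swap a b K c) v =
    (if v \<in> K then transpose a b ` missing E k c v else missing E k c v)"
proof (cases "v \<in> K")
  case True
  have "i \<in> missing E k (kempe_swap a b K c) v \<longleftrightarrow> transpose a b i \<in> missing E k c v" for i
  proof -
    have "i \<le> k \<longleftrightarrow> transpose a b i \<le> k" using ab by (auto simp: transpose_def)
    moreover have "kempe_swap a b K c e \<noteq> i \<longleftrightarrow> c e \<noteq> transpose a b i" if "v \<in> e" for e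
      using kempe_swap_inside[OF that True] by (metis transpose_involutory)
    ultimately show ?thesis by (auto simp: missing_def)
  qed
  then have "missing E k (kempe_swap a b K c) v = transpose a b ` missing E k c v"
    by (auto simp: image_iff) (metis transpose_involutory)
  then show ?thesis using True by simp
next
  case False
  then show ?thesis using kempe_swap_outside[of _ v] by (auto simp: missing_def)
qed

end

text \<open>Vizing's fan argument. Take a maximal fan, \<open>\<alpha>\<close> missing at
  \<open>x\<close> and \<open>\<beta>\<close> missing at the last fan vertex. If shifting fails, the
  \<open>\<beta>\<close>-edge at \<open>x\<close> leads to a fan vertex \<open>w\<close>, whose
  predecessor \<open>p\<close> also misses \<open>\<beta>\<close>. Then \<open>x\<close>,
  \<open>p\<close> and the last vertex have degree at most one in the subgraph of these two colours,
  so the component of \<open>x\<close> omits \<open>p\<close> or the last vertex, and a swap at the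
  omitted one makes \<open>\<alpha>\<close> available at the end of a fan.\<close>

lemma edge_colouring_insert:
  assumes fin: "finite E" and two: "\<forall>e\<in>E. card e = 2"
    and deg: "\<And>v. card {e\<in>E. v \<in> e} \<le> k"
    and xy: "{x, y} \<in> E" and col: "edge_colouring (E - {{x, y}}) k c"
  shows "\<exists>c'. edge_colouring E k c'"
proof (rule ccontr)
  assume no: "\<not> ?thesis"
  let ?D = "E - {{x, y}}"
  let ?fan = "\<lambda>c. successively (\<lambda>a b. c {x, b} \<in> missing ?D k c a)"
  have twoD: "\<forall>e\<in>?D. card e = 2" using two by blast
  have finD: "finite ?D" using fin by blast
  have degD: "card {e\<in>?D. v \<in> e} \<le> k" for v
    by (rule order_trans[OF card_mono deg[of v]]) (use fin in auto)
  define P where "P ys \<longleftrightarrow> distinct (y # ys) \<and> (\<forall>z\<in>set (y # ys). {x, z} \<in> E) \<and> ?fan c (y # ys)" for ys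
  have "P []" using xy by (simp add: P_def)
  moreover have "length ys < Suc (card (\<Union>E))" if "P ys" for ys
  proof -
    have "length ys = card (set ys)" using that by (simp add: P_def distinct_card)
    also have "\<dots> \<le> card (\<Union>E)"
      using that finite_Union_card2[OF fin bspec[OF two]] by (intro card_mono) (auto simp: P_def)
    finally show ?thesis by simp
  qed
  ultimately obtain ys where ys: "P ys" and max: "\<And>zs. P zs \<Longrightarrow> length zs \<le> length ys"
    using ex_has_greatest_nat[of P "[]" length "Suc (card (\<Union>E))"] by metis
  let ?l = "last (y # ys)"
  obtain \<alpha> where \<alpha>: "\<alpha> \<in> missing ?D k c x" using missing_nonempty[OF finD degD] by blast
  obtain \<beta> where \<beta>: "\<beta> \<in> missing ?D k c ?l" using missing_nonempty[OF finD degD] by blast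
  have \<beta>x: "\<beta> \<notin> missing ?D k c x"
    using fan_shift[OF two, where x = x and y = y and ys = ys and k = k and c = c and g = \<beta>] ys col \<beta> no
    unfolding P_def by metis
  have le: "\<alpha> \<le> k" "\<beta> \<le> k" using \<alpha> \<beta> by (auto simp: missing_def)
  have ne: "\<alpha> \<noteq> \<beta>" using \<alpha> \<beta>x by blast
  obtain e where e: "e \<in> ?D" "x \<in> e" "c e = \<beta>" using \<beta>x le by (auto simp: missing_def)
  obtain w where w: "e = {x, w}" "w \<noteq> x" using card2_other[OF bspec[OF twoD e(1)] e(2)] .
  have wy: "w \<noteq> y" using e w by auto
  have "w \<in> set ys"
  proof (rule ccontr)
    assume "w \<notin> set ys"
    then have "P (ys @ [w])"
      using ys e w wy \<beta> successively_append_iff[of _ "y # ys" "[w]"] unfolding P_def by auto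
    then show False using max by fastforce
  qed
  then obtain as bs where "ys = as @ w # bs" by (meson split_list)
  then obtain p cs where p: "y # ys = cs @ p # w # bs"
    by (cases as rule: rev_cases) (auto intro: that[of "[]"] that[of "y # _"])
  have dist: "distinct (cs @ p # w # bs)" using ys p by (simp add: P_def)
  have p\<beta>: "\<beta> \<in> missing ?D k c p"
    using ys e w unfolding P_def p by (auto simp: successively_append_iff)
  have pl: "p \<noteq> ?l" using dist unfolding p by auto
  have xne: "x \<noteq> z" if "z \<in> set (y # ys)" for z
    using bspec[OF two, of "{x,z}"] ys that by (auto simp: P_def)
  have xD: "{x, z} \<in> ?D" if "z \<in> set (y # ys)" "z \<noteq> y" for z
    using ys that by (auto simp: P_def doubleton_eq_iff)
  have uniq: "z = w" if "z \<in> set (y # ys)" "z \<noteq> y" "c {x, z} = \<beta>" for z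
    using edge_colouring_unique[OF col xD[OF that(1,2)] e(1), of x] that e w
    by (auto simp: doubleton_eq_iff)
  let ?S = "{e\<in>?D. c e = \<alpha> \<or> c e = \<beta>}"
  txt \<open>Recolouring the two-coloured component of the end of the fan frees \<open>\<alpha>\<close> there.\<close>
  have swap: False if K: "K = reach ?S q" and xK: "x \<notin> K" and zs: "y # ys = (y # zs) @ us"
      and q: "q = last (y # zs)" "\<beta> \<in> missing ?D k c q"
      and pq: "p \<notin> K \<or> w \<notin> set zs" for K q zs us
  proof -
    let ?c = "kempe_swap \<alpha> \<beta> K c"
    note ks = kempe_swap_outside[OF twoD col le K]
    note mk = missing_kempe_swap[OF twoD col le K]
    have sub: "set (y # zs) \<subseteq> set (y # ys)" using zs by auto
    have dz: "distinct (y # zs)" using ys zs unfolding P_def by auto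
    have "?fan c ((y # zs) @ us)" using ys unfolding P_def zs by blast
    then have fan0: "?fan c (y # zs)" unfolding successively_append_iff by blast
    have "?c {x, b} \<in> missing ?D k ?c a"
      if abm: "Suc i < length (y # zs)" "a = (y # zs) ! i" "b = (y # zs) ! Suc i" for i a b
    proof -
      have b: "b \<in> set zs" "a \<in> set (y # zs)" using abm nth_mem[of i "y # zs"] by auto
      have m: "c {x, b} \<in> missing ?D k c a"
        using successively_nth[OF fan0] abm by simp
      have bny: "b \<noteq> y" using dz b by auto
      have bD: "{x, b} \<in> ?D" using xD[of b] b sub bny by auto
      have cb: "?c {x, b} = c {x, b}" using ks[OF bD, of x] xK by simp
      have nea: "c {x, b} \<noteq> \<alpha>" using \<alpha> bD by (auto simp: missing_def)
      show ?thesis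
      \<comment> \<open>Only the spoke to \<open>w\<close> has colour \<open>\<beta>\<close> and
        none has colour \<open>\<alpha>\<close>, so the swap can spoil the fan only at the
        consecutive pair \<open>p\<close>, \<open>w\<close>; \<open>pq\<close> rules this
        out.\<close>
      proof (cases "b = w")
        case True
        have len: "Suc i < length (y # ys)" "a = (y # ys) ! i" "b = (y # ys) ! Suc i"
          using abm nth_append[of "y # zs" us i] nth_append[of "y # zs" us "Suc i"]
          unfolding zs by auto
        have "(y # ys) ! Suc (length cs) = w" "Suc (length cs) < length (y # ys)"
          unfolding p by (auto simp: nth_append)
        then have "Suc i = Suc (length cs)"
          using len True dist nth_eq_iff_index_eq[of "y # ys"] unfolding p by metis
        then have "a = p" using len unfolding p by simp
        then have "a \<notin> K" using pq True b by auto
        then show ?thesis using cb m mk by simp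
      next
        case False
        then have "c {x, b} \<noteq> \<beta>" using uniq[of b] b sub bny by auto
        then have "c {x, b} = transpose \<alpha> \<beta> (c {x, b})" using nea by (simp add: transpose_def)
        then show ?thesis using cb m mk by auto
      qed
    qed
    then have fan: "?fan ?c (y # zs)" unfolding successively_conv_nth by blast
    have gx: "\<alpha> \<in> missing ?D k ?c x" using mk xK \<alpha> by simp
    have "q \<in> K" using K reach_refl by simp
    then have "\<alpha> \<in> missing ?D k ?c q" using mk q by (auto intro!: image_eqI[of _ _ \<beta>])
    then have gq: "\<alpha> \<in> missing ?D k ?c (last (y # zs))" using q by simp
    have "\<forall>z\<in>set (y # zs). {x, z} \<in> E" using ys sub unfolding P_def by blast
    from fan_shift[OF two dz this edge_colouring_kempe_swap[OF twoD col le K] fan gx gq]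
    show False using no by blast
  qed
  have d1: "card {e\<in>?S. v \<in> e} \<le> 1" if "\<alpha> \<in> missing ?D k c v \<or> \<beta> \<in> missing ?D k c v" for v
  proof -
    have "e = f" if ef: "e \<in> {e\<in>?S. v \<in> e}" "f \<in> {e\<in>?S. v \<in> e}" for e f
    proof -
      have "\<not> (c e = \<alpha> \<and> c f = \<beta>)" "\<not> (c e = \<beta> \<and> c f = \<alpha>)"
        using ef \<open>\<alpha> \<in> _ \<or> \<beta> \<in> _\<close> unfolding missing_def by blast+
      then have "c e = c f" using ef by auto
      then show ?thesis using ef edge_colouring_unique[OF col, of e f v] by blast
    qed
    then show ?thesis using finD by (simp add: card_le_Suc0_iff_eq)
  qed
  have d2: "card {e\<in>?S. v \<in> e} \<le> 2" for v
  proof -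
    have "inj_on c {e\<in>?S. v \<in> e}"
      by (intro inj_onI, rule edge_colouring_unique[OF col, of _ _ v]) blast+
    then have "card {e\<in>?S. v \<in> e} = card (c ` {e\<in>?S. v \<in> e})" by (simp add: card_image)
    also have "\<dots> \<le> card {\<alpha>, \<beta>}" by (intro card_mono) auto
    finally show ?thesis using ne by simp
  qed
  have twoS: "\<forall>e\<in>?S. card e = 2" using two by blast
  have finS: "finite ?S" using finD by simp
  have "p \<in> set (y # ys)" unfolding p by simp
  moreover have "?l \<in> set (y # ys)" by (rule last_in_set) simp
  ultimately have "x \<noteq> p" "x \<noteq> ?l" using xne by blast+
  then have "p \<notin> reach ?S x \<or> ?l \<notin> reach ?S x"
    using three_ends_not_connected[OF finS twoS d2 d1 d1 d1 _ _ pl, of x] \<alpha> \<beta> p\<beta> by blast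
  then show False
  \<comment> \<open>If \<open>p\<close> is outside the component of \<open>x\<close>, the fan is cut
    off after \<open>p\<close>, hence before \<open>w\<close>. Otherwise the whole fan is kept, and
    \<open>p\<close> is not in the component that is swapped.\<close>
  proof (cases "p \<in> reach ?S x")
    case False
    then have xK: "x \<notin> reach ?S p" using reach_sym by metis
    obtain zs where zs: "cs @ [p] = y # zs" using p by (cases cs) auto
    have "y # ys = (y # zs) @ w # bs" using p zs by (metis append.assoc append_Cons append_Nil)
    moreover have "p = last (y # zs)" using zs by (metis last_snoc)
    moreover have "w \<notin> set zs" using dist zs by (cases cs) auto
    ultimately show False using swap[OF refl xK] p\<beta> by blast
  next
    case True
    then have l: "?l \<notin> reach ?S x" using \<open>p \<notin> _ \<or> _\<close> by blast
    then have xK: "x \<notin> reach ?S ?l" using reach_sym by metis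
    have "p \<notin> reach ?S ?l" using True l reach_sym[of p ?S ?l] reach_trans[of p ?S x ?l] by blast
    then show False using swap[OF refl xK, of ys "[]"] \<beta> by simp
  qed
qed

theorem Vizing:
  assumes "finite E" "\<And>e. e \<in> E \<Longrightarrow> card e = 2" "\<And>v. card {e\<in>E. v \<in> e} \<le> k"
  shows "\<exists>c. edge_colouring E k c"
  using assms
proof (induction "card E" arbitrary: E)
  case 0
  then show ?case by (auto simp: edge_colouring_def)
next
  case (Suc n)
  then obtain e where e: "e \<in> E" by fastforce
  then obtain x y where xy: "e = {x, y}" using Suc.prems(2) by (meson card_2_iff)
  have "\<exists>c. edge_colouring (E - {e}) k c"
  proof (rule Suc.hyps(1))
    show "n = card (E - {e})" using Suc.hyps(2) e Suc.prems(1) by simp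
    show "card {f\<in>E - {e}. v \<in> f} \<le> k" for v
      by (rule order_trans[OF card_mono Suc.prems(3)[of v]]) (use Suc.prems in auto)
  qed (use Suc.prems in auto)
  then obtain c where "edge_colouring (E - {{x, y}}) k c" using xy by blast
  then show ?case using edge_colouring_insert[of E k x y c] Suc.prems e xy by blast
qed

section \<open>Regular graphs of large girth\<close>

text \<open>The ball of radius \<open>L\<close> in the \<open>d\<close>-regular tree with properly
  coloured edges: a word lists the colours on the way from a vertex to the root \<open>[]\<close>,
  and a path without backtracking never repeats a colour at once.\<close>

definition reduced_words :: "nat \<Rightarrow> nat \<Rightarrow> nat list set" where
  "reduced_words d L = {w. set w \<subseteq> {..<d} \<and> length w \<le> L \<and> distinct_adj w}"

text \<open>A word of length \<open>L\<close> has no edge leading outwards and is then left fixed,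
  as is everything outside the ball; this makes the walk along colour \<open>i\<close> an
  involution.\<close>

definition toggle :: "nat \<Rightarrow> nat \<Rightarrow> nat \<Rightarrow> nat list \<Rightarrow> nat list" where
  "toggle d L i w =
     (if w \<notin> reduced_words d L then w
      else if w \<noteq> [] \<and> hd w = i then tl w
      else if length w < L then i # w else w)"

lemma finite_reduced_words: "finite (reduced_words d L)"
  by (rule finite_subset[OF _ finite_lists_length_le[of "{..<d}" L]]) (auto simp: reduced_words_def)

lemma toggle_in:
  assumes "i < d" "w \<in> reduced_words d L"
  shows "toggle d L i w \<in> reduced_words d L"
  using assms by (cases w) (auto simp: toggle_def reduced_words_def distinct_adj_Cons)

lemma toggle_toggle:
  assumes "i < d"
  shows "toggle d L i (toggle d L i w) = w"
proof (cases "w \<in> reduced_words d L")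
  case True
  note T = toggle_in[OF assms True]
  consider (del) w' where "w = i # w'" | (add) "w = [] \<or> hd w \<noteq> i" "length w < L"
    | (stay) "w = [] \<or> hd w \<noteq> i" "\<not> length w < L"
    by (cases w) auto
  then show ?thesis
  proof cases
    case del
    then have t: "toggle d L i w = w'" using True by (simp add: toggle_def)
    have "w' = [] \<or> hd w' \<noteq> i" "length w' < L"
      using True del by (auto simp: reduced_words_def distinct_adj_Cons)
    then show ?thesis using t T del by (auto simp: toggle_def)
  next
    case add
    then have t: "toggle d L i w = i # w" using True by (auto simp: toggle_def)
    then show ?thesis using T by (simp add: toggle_def)
  next
    case stay
    then have "toggle d L i w = w" using True by (auto simp: toggle_def)
    then show ?thesis by simp
  qed
qed (simp add: toggle_def)

lemma toggle_permutes:
  assumes "i < d"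
  shows "toggle d L i permutes reduced_words d L"
proof (rule bij_imp_permutes)
  show "bij_betw (toggle d L i) (reduced_words d L) (reduced_words d L)"
    by (rule bij_betw_byWitness[where f' = "toggle d L i"])
      (use toggle_in toggle_toggle assms in auto)
qed (simp add: toggle_def)

lemma even_card_if_involution:
  assumes "finite A" "\<And>x. x \<in> A \<Longrightarrow> h x \<in> A" "\<And>x. x \<in> A \<Longrightarrow> h x \<noteq> x" "\<And>x. x \<in> A \<Longrightarrow> h (h x) = x"
  shows "even (card A)"
  using assms
proof (induction "card A" arbitrary: A rule: less_induct)
  case less
  show ?case
  proof (cases "A = {}")
    case False
    then obtain x where x: "x \<in> A" by blast
    let ?B = "A - {x, h x}"
    have c: "card A = card ?B + 2"
    proof -
      have "card {x, h x} = 2" using less.prems(3)[OF x] by auto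
      moreover have "{x, h x} \<subseteq> A" using x less.prems(2) by blast
      ultimately show ?thesis
        using less.prems(1) card_Diff_subset[of "{x, h x}" A] card_mono[of A "{x, h x}"] by auto
    qed
    have "even (card ?B)"
    proof (rule less.hyps)
      show "card ?B < card A" using c by simp
      show "finite ?B" using less.prems by simp
      fix y assume y: "y \<in> ?B"
      have "h y \<noteq> x" "h y \<noteq> h x" using y x less.prems(4)[of y] less.prems(4)[of x] by auto
      then show "h y \<in> ?B" using y less.prems(2)[of y] by blast
    qed (use less.prems in auto)
    then show ?thesis using c by simp
  qed simp
qed

text \<open>Biggs' construction: the Cayley graph of the permutations of the truncated \<open>d\<close>-regular
  tree with respect to the \<open>d\<close> involutions that walk along the edges of a fixed colour. A short
  cycle would be a reduced word fixing the root.\<close>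

lemma regular_sparse_graph_exists:
  assumes "1 \<le> L"
  obtains V :: "(nat list \<Rightarrow> nat list) set" and E where
    "finite V" "V \<noteq> {}" "\<And>e. e \<in> E \<Longrightarrow> e \<subseteq> V \<and> card e = 2"
    "\<And>v. v \<in> V \<Longrightarrow> card {e\<in>E. v \<in> e} = d" "sparse L E"
    "0 < d \<Longrightarrow> \<exists>h. \<forall>v\<in>V. {v, h v} \<in> E \<and> h v \<noteq> v \<and> h (h v) = v"
proof -
  let ?T = "reduced_words d L" and ?s = "toggle d L"
  define V where "V = {p. p permutes ?T}"
  define E where "E = {{p, ?s i \<circ> p} | p i. p \<in> V \<and> i < d}"
  have nil: "[] \<in> ?T" by (simp add: reduced_words_def)
  \<comment> \<open>Since \<open>1 \<le> L\<close>, the involutions send the root to distinct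
    neighbours. Every permutation takes the root as a value, so different colours lead to different
    neighbours and none to a loop.\<close>
  have s_nil: "?s i [] = [i]" for i using assms nil by (simp add: toggle_def)
  have closed: "?s i \<circ> p \<in> V" if "i < d" "p \<in> V" for i p
    using that toggle_permutes permutes_compose unfolding V_def by blast
  have root: "\<exists>t. p t = []" if "p \<in> V" for p
    using that permutes_surj unfolding V_def by (metis mem_Collect_eq surj_def)
  have inj: "i = j" if "p \<in> V" "?s i \<circ> p = ?s j \<circ> p" for i j p
    using root[OF that(1)] that(2) s_nil by (metis comp_apply list.inject)
  have nofix: "?s i \<circ> p \<noteq> p" if "p \<in> V" for i p
    using root[OF that] s_nil by (metis comp_apply list.distinct(1))
  have inv: "?s i \<circ> (?s i \<circ> p) = p" if "i < d" for i p
    using toggle_toggle[OF that] by (simp add: fun_eq_iff)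
  have fin: "finite V" unfolding V_def using finite_reduced_words by (rule finite_permutations)
  have edge: "\<exists>i<d. q = ?s i \<circ> p" if pq: "{p, q} \<in> E" for p q
  proof -
    obtain r i where ri: "{p, q} = {r, ?s i \<circ> r}" "i < d"
      using pq unfolding E_def by auto
    then consider "p = r" "q = ?s i \<circ> r" | "p = ?s i \<circ> r" "q = r" by (auto simp: doubleton_eq_iff)
    then have "q = ?s i \<circ> p" using inv[OF ri(2), of r] by cases simp_all
    then show ?thesis using ri by blast
  qed
  have two: "e \<subseteq> V \<and> card e = 2" if e: "e \<in> E" for e
  proof -
    obtain p i where "e = {p, ?s i \<circ> p}" "p \<in> V" "i < d" using e unfolding E_def by auto
    then show ?thesis using closed[of i p] nofix[of p i] by simp
  qed
  have "card {e\<in>E. v \<in> e} = d" if v: "v \<in> V" for v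
  proof -
    have "{e\<in>E. v \<in> e} = (\<lambda>i. {v, ?s i \<circ> v}) ` {..<d}"
    proof (intro equalityI subsetI)
      fix e assume "e \<in> {e\<in>E. v \<in> e}"
      then have e: "e \<in> E" "v \<in> e" by auto
      then obtain w where "e = {v, w}" using two card2_other by metis
      then show "e \<in> (\<lambda>i. {v, ?s i \<circ> v}) ` {..<d}" using edge[of v w] e by auto
    qed (use v in \<open>auto simp: E_def\<close>)
    moreover have "inj_on (\<lambda>i. {v, ?s i \<circ> v}) {..<d}"
      using inj[OF v] by (auto intro!: inj_onI simp: doubleton_eq_iff)
    ultimately show ?thesis by (simp add: card_image)
  qed
  moreover have "sparse L E"
  proof (rule sparse_if_no_short_cycle)
    fix vs assume cyc: "is_cycle (V, E) vs"
    let ?n = "length vs"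
    have n3: "3 \<le> ?n" and dist: "distinct vs"
      and adj: "\<And>i. i < ?n \<Longrightarrow> {vs ! i, vs ! (Suc i mod ?n)} \<in> E"
      using cyc by (auto simp: is_cycle_def)
    show "L < ?n"
    proof (rule ccontr)
      assume "\<not> L < ?n"
      then have nL: "?n \<le> L" by simp
      let ?p = "\<lambda>k. vs ! (k mod ?n)"
      have "\<exists>i<d. ?p (Suc k) = ?s i \<circ> ?p k" for k
      proof -
        have "k mod ?n < ?n" using n3 by (intro mod_less_divisor) linarith
        then show ?thesis using edge[OF adj[of "k mod ?n"]] by (simp add: mod_Suc_eq)
      qed
      then obtain c where c: "\<And>k. c k < d" "\<And>k. ?p (Suc k) = ?s (c k) \<circ> ?p k" by metis
      \<comment> \<open>The same involution twice in a row would undo the step, and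
        \<open>?n\<close> would divide \<open>2\<close>.\<close>
      have c_ne: "c (Suc k) \<noteq> c k" for k
      proof
        assume "c (Suc k) = c k"
        then have "?p (Suc (Suc k)) = ?p k" using c inv by metis
        then have "Suc (Suc k) mod ?n = k mod ?n"
          using nth_eq_iff_index_eq[OF dist] n3 by (metis gr_zeroI mod_less_divisor not_numeral_le_zero)
        then have "?n dvd Suc (Suc k) - k" by (subst mod_eq_dvd_iff_nat[symmetric]) auto
        then show False using n3 dvd_imp_le[of ?n 2] by simp
      qed
      have "0 < ?n" using n3 by linarith
      then have "vs ! 0 \<in> V" using two[OF adj[of 0]] by simp
      then obtain t where t: "?p 0 t = []" using root by auto
      \<comment> \<open>The value at \<open>t\<close> starts at the root and moves one edge away
        from it in each step, because consecutive colours differ and \<open>?n \<le> L\<close> keeps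
        it inside the ball. After \<open>?n\<close> steps the cycle has closed, yet the value is not
        the root.\<close>
      have walk: "k \<le> ?n \<Longrightarrow> ?p k t \<in> ?T \<and> length (?p k t) = k \<and> (0 < k \<longrightarrow> hd (?p k t) = c (k - 1))" for k
      proof (induction k)
        case 0 then show ?case using t nil by simp
      next
        case (Suc k)
        let ?w = "?p k t"
        have IH: "?w \<in> ?T" "length ?w = k" "0 < k \<Longrightarrow> hd ?w = c (k - 1)" using Suc by auto
        have "?w = [] \<or> hd ?w \<noteq> c k"
          using IH c_ne[of "k - 1"] by (cases k) auto
        then have "?s (c k) ?w = c k # ?w" using IH Suc.prems nL by (auto simp: toggle_def)
        moreover have "?p (Suc k) t = ?s (c k) ?w" using c(2)[of k] by simp
        moreover have "?s (c k) ?w \<in> ?T" using IH c(1) by (intro toggle_in)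
        ultimately show ?case using IH by simp
      qed
      show False using walk[of ?n] t n3 by simp
    qed
  qed (use two in blast)
  \<comment> \<open>The edges of colour \<open>0\<close> form a perfect matching, on which the
    parity argument for the gadget rests.\<close>
  moreover have "\<exists>h. \<forall>v\<in>V. {v, h v} \<in> E \<and> h v \<noteq> v \<and> h (h v) = v" if "0 < d"
    by (rule exI[of _ "\<lambda>v. ?s 0 \<circ> v"]) (use that nofix inv in \<open>auto simp: E_def\<close>)
  moreover have "V \<noteq> {}" unfolding V_def using permutes_id by blast
  ultimately show thesis using that fin two by blast
qed

section \<open>A regular graph that is not class one\<close>

text \<open>The gadget consists of \<open>d\<close> copies of the graph \<open>E\<close> without the edge \<open>uv\<close> and two further vertices.
  The two loose ends of copy \<open>0\<close> are attached to \<open>Inl False\<close>, those of copy \<open>1\<close> to \<open>Inl True\<close>, and every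
  other copy joins \<open>Inl False\<close> to \<open>Inl True\<close>, which makes the gadget \<open>d\<close>-regular. In a colouring with
  \<open>d\<close> colours the two ends of copy \<open>0\<close> would by parity have the same colour.\<close>

definition copy :: "nat \<Rightarrow> 'h set \<Rightarrow> (bool + nat \<times> 'h) set" where
  "copy i e = (\<lambda>p. Inr (i, p)) ` e"

definition link_u :: "'h \<Rightarrow> nat \<Rightarrow> (bool + nat \<times> 'h) set" where
  "link_u u i = {Inl (i = 1), Inr (i, u)}"

definition link_v :: "'h \<Rightarrow> nat \<Rightarrow> (bool + nat \<times> 'h) set" where
  "link_v v i = {Inl (i \<noteq> 0), Inr (i, v)}"

definition gadget_edges :: "nat \<Rightarrow> 'h set set \<Rightarrow> 'h \<Rightarrow> 'h \<Rightarrow> (bool + nat \<times> 'h) set set" where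
  "gadget_edges d E u v = (\<Union>i<d. copy i ` (E - {{u, v}})) \<union> link_u u ` {..<d} \<union> link_v v ` {..<d}"

definition gadget_verts :: "nat \<Rightarrow> 'h set \<Rightarrow> (bool + nat \<times> 'h) set" where
  "gadget_verts d V = range Inl \<union> Inr ` ({..<d} \<times> V)"

lemma copy_inj: "copy i e = copy i f \<longleftrightarrow> e = f"
  unfolding copy_def by (rule inj_image_eq_iff) (auto intro: injI)

lemma mem_copy [simp]: "Inr (j, p) \<in> copy i e \<longleftrightarrow> j = i \<and> p \<in> e" "Inl b \<notin> copy i e"
  by (auto simp: copy_def)

lemma mem_link [simp]:
  "Inr (j, p) \<in> link_u u i \<longleftrightarrow> j = i \<and> p = u" "Inl b \<in> link_u u i \<longleftrightarrow> b = (i = 1)"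
  "Inr (j, p) \<in> link_v v i \<longleftrightarrow> j = i \<and> p = v" "Inl b \<in> link_v v i \<longleftrightarrow> b = (i \<noteq> 0)"
  by (auto simp: link_u_def link_v_def)

lemma link_neq_copy: "link_u u i \<noteq> copy j e" "link_v v i \<noteq> copy j e"
  by (metis mem_copy(2) mem_link(2), metis mem_copy(2) mem_link(4))

lemma gadget_edge_cases:
  assumes "e \<in> gadget_edges d E u v"
  obtains (copy) i f where "i < d" "f \<in> E - {{u, v}}" "e = copy i f"
    | (link_u) i where "i < d" "e = link_u u i" | (link_v) i where "i < d" "e = link_v v i"
  using assms unfolding gadget_edges_def by blast

lemma gadget_edge_at_Inr:
  assumes "e \<in> gadget_edges d E u v" "Inr (i, p) \<in> e"
  obtains (copy) f where "f \<in> E - {{u, v}}" "e = copy i f" "p \<in> f"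
    | (link_u) "e = link_u u i" "p = u" | (link_v) "e = link_v v i" "p = v"
  using assms(1)
proof (cases rule: gadget_edge_cases)
  case (copy j f)
  then show ?thesis using assms(2) that(1)[of f] by simp
next
  case (link_u j)
  then show ?thesis using assms(2) that(2) by simp
next
  case (link_v j)
  then show ?thesis using assms(2) that(3) by simp
qed

lemma card_disjoint_pairs_even:
  assumes "finite M" "\<And>e. e \<in> M \<Longrightarrow> card e = 2" "\<And>e f. e \<in> M \<Longrightarrow> f \<in> M \<Longrightarrow> e \<noteq> f \<Longrightarrow> e \<inter> f = {}"
  shows "even (card (\<Union>M))"
proof -
  have "card (\<Union>M) = sum card M"
    using assms by (intro card_Union_disjoint) (auto simp: pairwise_def disjnt_def card_ge_0_finite)
  also have "\<dots> = (\<Sum>e\<in>M. 2)" using assms by (intro sum.cong) auto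
  finally show ?thesis by simp
qed

context
  fixes V :: "'h set" and E :: "'h set set" and u v :: 'h and d L :: nat and h
  assumes finV: "finite V" and EV: "\<forall>e\<in>E. e \<subseteq> V \<and> card e = 2"
    and reg: "\<forall>p\<in>V. card {e\<in>E. p \<in> e} = d" and spL: "sparse L E"
    and h: "\<forall>p\<in>V. {p, h p} \<in> E \<and> h p \<noteq> p \<and> h (h p) = p"
    and uv: "{u, v} \<in> E" and d2: "2 \<le> d"
begin

private lemma u_neq_v: "u \<noteq> v"
  using EV uv by fastforce

private lemma finE: "finite E"
  by (rule finite_subset[of _ "Pow V"]) (use EV finV in auto)

lemma gadget_simple:
  assumes "e \<in> gadget_edges d E u v"
  shows "e \<subseteq> gadget_verts d V \<and> card e = 2"
proof -
  have uvV: "u \<in> V" "v \<in> V" using EV uv by auto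
  from assms show ?thesis
  proof (cases rule: gadget_edge_cases)
    case (copy i f)
    then have "card e = card f" by (simp add: copy_def card_image inj_on_def)
    then show ?thesis using copy EV by (auto simp: copy_def gadget_verts_def)
  qed (use uvV in \<open>auto simp: link_u_def link_v_def gadget_verts_def\<close>)
qed

lemma gadget_degree:
  assumes "a \<in> gadget_verts d V"
  shows "card {e\<in>gadget_edges d E u v. a \<in> e} = d"
proof (cases a)
  case (Inl b)
  let ?A = "{i. i < d \<and> b = (i = 1)}" and ?B = "{i. i < d \<and> b = (i \<noteq> 0)}"
  have "{e\<in>gadget_edges d E u v. a \<in> e} = link_u u ` ?A \<union> link_v v ` ?B"
    unfolding gadget_edges_def Inl by (auto simp: image_iff)
  moreover have "link_u u ` ?A \<inter> link_v v ` ?B = {}"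
    using u_neq_v by (auto simp: link_u_def link_v_def doubleton_eq_iff)
  moreover have "inj_on (link_u u) ?A" "inj_on (link_v v) ?B"
    by (auto simp: inj_on_def link_u_def link_v_def doubleton_eq_iff)
  ultimately have "card {e\<in>gadget_edges d E u v. a \<in> e} = card ?A + card ?B"
    by (simp add: card_Un_disjoint card_image)
  moreover have "card ?A + card ?B = d"
  proof (cases b)
    case True
    then have "?A = {1}" "?B = {1..<d}" using d2 by auto
    then show ?thesis using d2 by simp
  next
    case False
    then have "?A = {..<d} - {1}" "?B = {0}" using d2 by auto
    then show ?thesis using d2 by simp
  qed
  ultimately show ?thesis by simp
next
  case (Inr ip)
  then obtain i p where a: "a = Inr (i, p)" "i < d" "p \<in> V"
    using assms by (auto simp: gadget_verts_def)
  \<comment> \<open>The bijection from the edges at \<open>p\<close> in \<open>E\<close> to the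
    edges at \<open>a\<close>: if \<open>p\<close> is an end of the deleted edge
    \<open>{u, v}\<close>, the link at \<open>p\<close> takes the place of that edge.\<close>
  let ?f = "\<lambda>e. if e = {u, v} then (if p = u then link_u u i else link_v v i) else copy i e"
  have eq: "{e\<in>gadget_edges d E u v. a \<in> e} = ?f ` {e\<in>E. p \<in> e}" (is "?l = ?r")
  proof (intro equalityI subsetI)
    fix e assume "e \<in> ?l"
    then have "e \<in> gadget_edges d E u v" "Inr (i, p) \<in> e" using a by auto
    then show "e \<in> ?r"
    proof (cases rule: gadget_edge_at_Inr)
      case (copy f) then show ?thesis by (intro image_eqI[of _ _ f]) auto
    next
      case link_u then show ?thesis using uv by (intro image_eqI[of _ _ "{u, v}"]) auto
    next
      case link_v then show ?thesis using uv u_neq_v by (intro image_eqI[of _ _ "{u, v}"]) auto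
    qed
  next
    fix e assume "e \<in> ?r"
    then show "e \<in> ?l" using a unfolding gadget_edges_def by (auto split: if_splits)
  qed
  have inj: "inj_on ?f {e\<in>E. p \<in> e}"
    by (auto simp: inj_on_def copy_inj link_neq_copy link_neq_copy[THEN not_sym] split: if_splits)
  show ?thesis unfolding eq card_image[OF inj] using reg a by simp
qed

text \<open>Links are charged to the copy they enter, and each copy has at least as many covered
  vertices as charged edges. If both links of a copy are in \<open>C\<close>, they act like the
  deleted edge: sparsity of \<open>B i\<close> together with \<open>{u, v}\<close> gives
  \<open>card (B i) + 2 \<le> card (P i)\<close>. The strict surplus comes from a vertex
  \<open>Inl b\<close> if links occur, and otherwise from a copy with \<open>B i\<close>
  nonempty.\<close>

lemma gadget_sparse: "sparse L (gadget_edges d E u v)"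
  unfolding sparse_def
proof (intro allI impI, elim conjE)
  fix C assume C: "C \<subseteq> gadget_edges d E u v" and finC: "finite C" and ne: "C \<noteq> {}" and L: "card C \<le> L"
  define B where "B i = {e\<in>E - {{u, v}}. copy i e \<in> C}" for i
  define U where "U = {i. i < d \<and> link_u u i \<in> C}"
  define W where "W = {i. i < d \<and> link_v v i \<in> C}"
  define P where "P i = \<Union>(B i) \<union> (if i \<in> U then {u} else {}) \<union> (if i \<in> W then {v} else {})" for i
  let ?b = "\<lambda>i. card (B i) + (if i \<in> U then 1 else 0) + (if i \<in> W then 1 else 0 :: nat)"
  have finB: "finite (B i)" for i using finE by (simp add: B_def)
  have finBU: "finite (\<Union>(B i))" for i
    using finB EV by (intro finite_Union_card2) (auto simp: B_def)
  have finP: "finite (P i)" for i using finBU by (simp add: P_def)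
  have finUW: "finite U" "finite W" by (auto simp: U_def W_def)
  have CBUW: "(\<exists>i<d. e \<in> copy i ` B i) \<or> e \<in> link_u u ` U \<or> e \<in> link_v v ` W" if e: "e \<in> C" for e
  proof -
    have "e \<in> gadget_edges d E u v" using C e by blast
    then show ?thesis
    proof (cases rule: gadget_edge_cases)
      case (copy i f)
      then have "f \<in> B i" using e by (simp add: B_def)
      then show ?thesis using copy by blast
    next
      case (link_u i)
      then have "i \<in> U" using e by (simp add: U_def)
      then show ?thesis using link_u by blast
    next
      case (link_v i)
      then have "i \<in> W" using e by (simp add: W_def)
      then show ?thesis using link_v by blast
    qed
  qed
  have "C \<subseteq> (\<Union>i<d. copy i ` B i) \<union> link_u u ` U \<union> link_v v ` W"
    by (intro subsetI) (simp add: Bex_def, use CBUW in blast)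
  then have "card C \<le> card ((\<Union>i<d. copy i ` B i) \<union> link_u u ` U \<union> link_v v ` W)"
    using finB finUW by (intro card_mono) auto
  also have "\<dots> \<le> card (\<Union>i<d. copy i ` B i) + card (link_u u ` U) + card (link_v v ` W)"
    by (meson add_right_mono card_Un_le order_trans)
  also have "\<dots> \<le> (\<Sum>i<d. card (B i)) + card U + card W"
  proof (intro add_mono)
    have "card (\<Union>i<d. copy i ` B i) \<le> (\<Sum>i<d. card (copy i ` B i))" by (rule card_UN_le) simp
    also have "\<dots> \<le> (\<Sum>i<d. card (B i))" using finB by (intro sum_mono card_image_le)
    finally show "card (\<Union>i<d. copy i ` B i) \<le> (\<Sum>i<d. card (B i))" .
  qed (use finUW in \<open>auto intro: card_image_le\<close>)
  also have "\<dots> = (\<Sum>i<d. ?b i)"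
  proof -
    have "U = {..<d} \<inter> {i. i \<in> U}" "W = {..<d} \<inter> {i. i \<in> W}" by (auto simp: U_def W_def)
    then have "card U = (\<Sum>i<d. if i \<in> U then 1 else 0)" "card W = (\<Sum>i<d. if i \<in> W then 1 else 0)"
      by (simp_all add: sum.If_cases)
    then show ?thesis by (simp add: sum.distrib)
  qed
  finally have upper: "card C \<le> (\<Sum>i<d. ?b i)" .
  \<comment> \<open>Only one link is counted, because the single edge \<open>{u, v}\<close> will
    stand in for both.\<close>
  have BL: "card (B i) + (if i \<in> U then 1 else 0) \<le> L" for i
  proof -
    let ?X = "copy i ` B i \<union> (if i \<in> U then {link_u u i} else {})"
    have "card (copy i ` B i) = card (B i)" by (intro card_image inj_onI) (simp add: copy_inj)
    moreover have "link_u u i \<notin> copy i ` B i" by (auto simp: link_neq_copy)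
    ultimately have "card ?X = card (B i) + (if i \<in> U then 1 else 0)" using finB by simp
    moreover have "card ?X \<le> card C" using finC by (intro card_mono) (auto simp: B_def U_def)
    ultimately show ?thesis using L by simp
  qed
  have sp: "card X < card (\<Union>X)" if "X \<subseteq> E" "finite X" "X \<noteq> {}" "card X \<le> L" for X
    using spL that unfolding sparse_def by blast
  have spB: "card (B i) < card (\<Union>(B i))" if "B i \<noteq> {}" for i
    using sp[of "B i"] that finB BL[of i] by (auto simp: B_def)
  have lower: "?b i \<le> card (P i)" for i
  proof (cases "i \<in> U \<and> i \<in> W")
    case True
    let ?X = "insert {u, v} (B i)"
    have "card ?X = Suc (card (B i))" using finB by (simp add: B_def)
    moreover have "card ?X < card (\<Union>?X)"
      using sp[of ?X] BL[of i] True uv finB \<open>card ?X = _\<close> by (auto simp: B_def)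
    moreover have "\<Union>?X = P i" using True by (auto simp: P_def)
    ultimately show ?thesis using True by simp
  next
    case False
    show ?thesis
    proof (cases "B i = {}")
      case True then show ?thesis using False by (auto simp: P_def)
    next
      case ne: False
      have "card (\<Union>(B i)) \<le> card (P i)" using finP by (intro card_mono) (auto simp: P_def)
      then show ?thesis using spB[OF ne] False by auto
    qed
  qed
  define H where "H = {b. Inl b \<in> \<Union>C}"
  have "Inr ` (SIGMA i:{..<d}. P i) \<union> Inl ` H \<subseteq> \<Union>C"
  proof
    fix z assume "z \<in> Inr ` (SIGMA i:{..<d}. P i) \<union> Inl ` H"
    then show "z \<in> \<Union>C"
    proof
      assume "z \<in> Inr ` (SIGMA i:{..<d}. P i)"
      then obtain i p where z: "z = Inr (i, p)" "p \<in> P i" by auto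
      then consider e where "p \<in> e" "copy i e \<in> C" | "p = u" "link_u u i \<in> C" | "p = v" "link_v v i \<in> C"
        by (auto simp: P_def B_def U_def W_def split: if_splits)
      then show ?thesis
      proof cases
        case (1 e) then show ?thesis using z by (intro UnionI[of "copy i e"]) auto
      next
        case 2 then show ?thesis using z by (intro UnionI[of "link_u u i"]) auto
      next
        case 3 then show ?thesis using z by (intro UnionI[of "link_v v i"]) auto
      qed
    qed (auto simp: H_def)
  qed
  moreover have "finite (\<Union>C)"
    using finC C gadget_simple by (intro finite_Union_card2) auto
  ultimately have "card (Inr ` (SIGMA i:{..<d}. P i) \<union> Inl ` H) \<le> card (\<Union>C)" by (intro card_mono)
  moreover have "card (Inr ` (SIGMA i:{..<d}. P i) \<union> Inl ` H) = (\<Sum>i<d. card (P i)) + card H"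
    using finP by (subst card_Un_disjoint) (auto simp: card_image)
  ultimately have PC: "(\<Sum>i<d. card (P i)) + card H \<le> card (\<Union>C)" by simp
  show "card C < card (\<Union>C)"
  proof (cases "U = {} \<and> W = {}")
    case True
    obtain e where "e \<in> C" using ne by blast
    then obtain i where i: "i < d" "B i \<noteq> {}"
      using True CBUW[of e] by auto
    have "(\<Sum>i<d. ?b i) < (\<Sum>i<d. card (P i))"
      by (rule sum_strict_mono_ex1) (use lower i spB True in \<open>auto simp: P_def\<close>)
    then show ?thesis using upper PC by linarith
  next
    case False
    then consider i where "link_u u i \<in> C" | i where "link_v v i \<in> C" by (auto simp: U_def W_def)
    then have "H \<noteq> {}"
    proof cases
      case (1 i) then show ?thesis using UnionI[of "link_u u i" C "Inl (i = 1)"] by (auto simp: H_def)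
    next
      case (2 i) then show ?thesis using UnionI[of "link_v v i" C "Inl (i \<noteq> 0)"] by (auto simp: H_def)
    qed
    then have "card H \<ge> 1" by (simp add: Suc_leI card_gt_0_iff)
    moreover have "(\<Sum>i<d. ?b i) \<le> (\<Sum>i<d. card (P i))" using lower by (intro sum_mono)
    ultimately show ?thesis using upper PC by linarith
  qed
qed

text \<open>If all colour sets along edges agree, the colour \<open>\<alpha>\<close> of the first link matches up all but one
  vertex of a union of components of \<open>E\<close> inside copy \<open>0\<close>; such a union has even size.\<close>

lemma gadget_colour_sets_differ:
  fixes c :: "(bool + nat \<times> 'h) set \<Rightarrow> 'c"
  assumes proper: "proper_edge_colouring (gadget_verts d V, gadget_edges d E u v) c"
  shows "\<exists>a b. {a, b} \<in> gadget_edges d E u v \<and>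
    c ` {e\<in>gadget_edges d E u v. a \<in> e} \<noteq> c ` {e\<in>gadget_edges d E u v. b \<in> e}"
proof (rule ccontr)
  let ?G = "gadget_edges d E u v"
  define S where "S a = c ` {e\<in>?G. a \<in> e}" for a
  assume "\<not> ?thesis"
  then have same: "\<And>a b. {a, b} \<in> ?G \<Longrightarrow> S a = S b" unfolding S_def by blast
  have uniq: "e = f" if "e \<in> ?G" "f \<in> ?G" "z \<in> e" "z \<in> f" "c e = c f" for e f z
    using proper that unfolding proper_edge_colouring_def by auto
  let ?lu = "link_u u 0" and ?lv = "link_v v 0"
  have G: "?lu \<in> ?G" "?lv \<in> ?G" using d2 by (auto simp: gadget_edges_def)
  have cG: "copy 0 e \<in> ?G" if "e \<in> E" "e \<noteq> {u, v}" for e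
    using that d2 by (auto simp: gadget_edges_def)
  define \<alpha> where "\<alpha> = c ?lu"
  have "?lu \<noteq> ?lv" using u_neq_v by (auto simp: link_u_def link_v_def doubleton_eq_iff)
  then have lv: "c ?lv \<noteq> \<alpha>" using uniq[OF G, of "Inl False"] by (auto simp: \<alpha>_def)
  define B where "B = {p\<in>V. \<alpha> \<in> S (Inr (0, p))}"
  \<comment> \<open>This includes the deleted edge \<open>{u, v}\<close>: both of its ends are
    linked to \<open>Inl False\<close>.\<close>
  have step: "S (Inr (0, p)) = S (Inr (0, q))" if "{p, q} \<in> E" for p q
  proof (cases "{p, q} = {u, v}")
    case True
    have "S (Inr (0, u)) = S (Inl False)" "S (Inr (0, v)) = S (Inl False)"
      using same[of "Inl False" "Inr (0, u)"] same[of "Inl False" "Inr (0, v)"] G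
      by (simp_all add: link_u_def link_v_def)
    then show ?thesis using True by (auto simp: doubleton_eq_iff)
  next
    case False
    then show ?thesis using same[of "Inr (0, p)" "Inr (0, q)"] cG[OF that] by (simp add: copy_def)
  qed
  have finB: "finite B" using finV by (simp add: B_def)
  \<comment> \<open>\<open>B\<close> is a union of components of \<open>E\<close>, and
    \<open>h\<close> pairs up the vertices inside each of them.\<close>
  have "even (card B)"
  proof (rule even_card_if_involution[OF finB])
    fix p assume p: "p \<in> B"
    have "{p, h p} \<in> E" using h p by (simp add: B_def)
    then show "h p \<in> B" using step[of p "h p"] p EV by (auto simp: B_def)
  qed (use h in \<open>auto simp: B_def\<close>)
  define M where "M = {e\<in>E - {{u, v}}. c (copy 0 e) = \<alpha>}"
  \<comment> \<open>The link at \<open>u\<close> has colour \<open>\<alpha>\<close> and the link at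
    \<open>v\<close> does not, so every vertex of \<open>B\<close> other than \<open>u\<close> has
    its \<open>\<alpha>\<close>-edge inside the copy.\<close>
  have "\<Union>M = B - {u}"
  proof (intro equalityI subsetI)
    fix p assume "p \<in> \<Union>M"
    then obtain e where e: "e \<in> E" "e \<noteq> {u, v}" "c (copy 0 e) = \<alpha>" "p \<in> e" by (auto simp: M_def)
    have "p \<noteq> u"
      using uniq[OF cG[OF e(1,2)] G(1), of "Inr (0, u)"] e
      by (auto simp: \<alpha>_def link_neq_copy(1)[THEN not_sym])
    moreover have "p \<in> V" using EV e by blast
    moreover have "\<alpha> \<in> S (Inr (0, p))"
      using e cG[OF e(1,2)] unfolding S_def by (intro image_eqI[of _ _ "copy 0 e"]) auto
    ultimately show "p \<in> B - {u}" by (simp add: B_def)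
  next
    fix p assume "p \<in> B - {u}"
    then obtain e where e: "e \<in> ?G" "Inr (0, p) \<in> e" "c e = \<alpha>" "p \<noteq> u" by (auto simp: B_def S_def)
    from e(1,2) show "p \<in> \<Union>M"
      by (cases rule: gadget_edge_at_Inr) (use e lv in \<open>auto simp: M_def\<close>)
  qed
  moreover have "even (card (\<Union>M))"
  proof (rule card_disjoint_pairs_even)
    show "finite M" using finE by (simp add: M_def)
    show "card e = 2" if "e \<in> M" for e using that EV by (auto simp: M_def)
    fix e f assume ef: "e \<in> M" "f \<in> M" "e \<noteq> f"
    show "e \<inter> f = {}"
    proof (rule ccontr)
      assume "e \<inter> f \<noteq> {}"
      then obtain p where p: "p \<in> e" "p \<in> f" by blast
      have "copy 0 e = copy 0 f"
        by (rule uniq[where z = "Inr (0, p)"]) (use ef p cG in \<open>auto simp: M_def\<close>)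
      then show False using ef by (simp add: copy_inj)
    qed
  qed
  moreover have "u \<in> B"
    using EV uv G by (auto simp: B_def S_def \<alpha>_def intro!: image_eqI[of _ _ ?lu])
  ultimately show False using \<open>even (card B)\<close> finB
    by (metis card_Suc_Diff1 even_Suc)
qed

end

section \<open>Greedy rainbow embeddings\<close>

text \<open>Vertices may still be identified, so a greedy step has only colours to avoid.\<close>

definition rainbow_hom :: "'a set set \<Rightarrow> 'b set set \<Rightarrow> ('b set \<Rightarrow> 'c) \<Rightarrow> ('a \<Rightarrow> 'b) \<Rightarrow> bool" where
  "rainbow_hom A E c f \<longleftrightarrow> (\<forall>e\<in>A. f ` e \<in> E) \<and> inj_on (\<lambda>e. c (f ` e)) A"

definition colours_at :: "'b set set \<Rightarrow> ('b set \<Rightarrow> 'c) \<Rightarrow> 'b \<Rightarrow> 'c set" where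
  "colours_at E c a = c ` {e\<in>E. a \<in> e}"

lemma rainbow_hom_pair:
  "f ` e1 \<in> E \<Longrightarrow> f ` e2 \<in> E \<Longrightarrow> c (f ` e1) \<noteq> c (f ` e2) \<Longrightarrow> rainbow_hom {e1, e2} E c f"
  unfolding rainbow_hom_def inj_on_def by auto

lemma rainbow_hom_add_leaf:
  assumes f: "rainbow_hom A E c f" and q: "q \<notin> \<Union>A" "p \<noteq> q"
    and t: "{f p, t} \<in> E" "c {f p, t} \<notin> (\<lambda>e. c (f ` e)) ` A"
  shows "rainbow_hom (insert {p, q} A) E c (f(q := t))"
proof -
  have same: "(f(q := t)) ` e = f ` e" if "e \<in> A" for e
    using that q by (intro image_cong) auto
  have new: "(f(q := t)) ` {p, q} = {f p, t}" using q by auto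
  have Apq: "A - {{p, q}} = A" using q by auto
  have inj: "inj_on (\<lambda>e. c ((f(q := t)) ` e)) A \<longleftrightarrow> inj_on (\<lambda>e. c (f ` e)) A"
    by (intro inj_on_cong) (simp only: same)
  have im: "(\<lambda>e. c ((f(q := t)) ` e)) ` A = (\<lambda>e. c (f ` e)) ` A"
    by (intro image_cong) (simp_all only: same)
  show ?thesis
    unfolding rainbow_hom_def
  proof (intro conjI ballI)
    fix e assume "e \<in> insert {p, q} A"
    then consider "e = {p, q}" | "e \<in> A" by blast
    then show "(f(q := t)) ` e \<in> E"
    proof cases
      case 1 then show ?thesis using t(1) by (simp only: new)
    next
      case 2 then show ?thesis using f unfolding rainbow_hom_def by (simp only: same)
    qed
  next
    show "inj_on (\<lambda>e. c ((f(q := t)) ` e)) (insert {p, q} A)"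
      unfolding inj_on_insert inj new Apq im
      using f t(2) unfolding rainbow_hom_def by blast
  qed
qed

lemma card_colours_at:
  assumes "proper_edge_colouring (V, E) c"
  shows "card (colours_at E c a) = card {e\<in>E. a \<in> e}"
  unfolding colours_at_def using assms
  by (intro card_image inj_onI) (auto simp: proper_edge_colouring_def)

text \<open>Only the forbidden colours that occur at \<open>a\<close> are counted. For the last edge
  \<open>R\<close> may have as many elements as there are colours at \<open>a\<close>, and one of
  them lying elsewhere is enough.\<close>

lemma free_colour_edge:
  assumes two: "\<forall>e\<in>E. card e = 2"
    and lt: "card (R \<inter> colours_at E c a) < card (colours_at E c a)"
  obtains t where "{a, t} \<in> E" "c {a, t} \<notin> R"
proof -
  have "\<not> colours_at E c a \<subseteq> R"
    using lt by (metis Int_absorb1 less_irrefl)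
  then obtain e where e: "e \<in> E" "a \<in> e" "c e \<notin> R" unfolding colours_at_def by auto
  then obtain t where "e = {a, t}" using card2_other two by metis
  then show thesis using e that by blast
qed

text \<open>Edges are added in the reverse of an order that strips off leaves outside the core.
  Before each addition fewer than \<open>d\<close> colours are in use, because
  \<open>card A \<le> d\<close>, so a colour at the image of \<open>p\<close> is free. Vertices not
  reached yet keep their value under \<open>f0\<close>; the labels \<open>l\<close> and
  \<open>K\<close>, in the application the copy and the component, keep all values in the right
  copy.\<close>

lemma greedy_rainbow_hom:
  assumes H: "\<forall>e\<in>E. e \<subseteq> V \<and> card e = 2" "\<forall>a\<in>V. card {e\<in>E. a \<in> e} = d"
    and lab: "\<And>a b. {a, b} \<in> E \<Longrightarrow> l a = l b"
    and proper: "proper_edge_colouring (V, E) c"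
    and f0: "rainbow_hom A0 E c f0" "\<forall>v\<in>X. f0 v \<in> V \<and> l (f0 v) = K v"
    and KA: "\<And>p q. {p, q} \<in> A \<Longrightarrow> K p = K q" and AX: "\<Union>A \<subseteq> X"
    and leaf: "\<And>B. A0 \<subset> B \<Longrightarrow> B \<subseteq> A \<Longrightarrow>
      \<exists>p q. {p, q} \<in> B - A0 \<and> p \<noteq> q \<and> q \<notin> U \<and> q \<notin> \<Union>(B - {{p, q}})"
    and A: "A0 \<subseteq> A" "finite A" "card A \<le> d"
  shows "\<exists>f. rainbow_hom A E c f \<and> (\<forall>v\<in>U. f v = f0 v) \<and> (\<forall>v\<in>X. f v \<in> V \<and> l (f v) = K v)"
proof -
  have "\<exists>f. rainbow_hom B E c f \<and> (\<forall>v\<in>U. f v = f0 v) \<and> (\<forall>v\<in>X. f v \<in> V \<and> l (f v) = K v)"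
    if "A0 \<subseteq> B" "B \<subseteq> A" for B
    using that
  proof (induction "card B" arbitrary: B rule: less_induct)
    case less
    have finB: "finite B" using less.prems A finite_subset by blast
    show ?case
    proof (cases "B = A0")
      case True then show ?thesis using f0 by blast
    next
      case False
      then obtain p q where pq: "{p, q} \<in> B - A0" "p \<noteq> q" "q \<notin> U" "q \<notin> \<Union>(B - {{p, q}})"
        using leaf[of B] less.prems by blast
      let ?B = "B - {{p, q}}"
      have lt: "card ?B < card B" using pq finB by (intro psubset_card_mono) auto
      obtain f where f: "rainbow_hom ?B E c f" "\<forall>v\<in>U. f v = f0 v" "\<forall>v\<in>X. f v \<in> V \<and> l (f v) = K v"
        using less.hyps[OF lt] less.prems pq by blast
      have "{p, q} \<subseteq> X" using pq(1) less.prems(2) AX by blast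
      then have pqX: "p \<in> X" "q \<in> X" by auto
      let ?R = "(\<lambda>e. c (f ` e)) ` ?B"
      have "card (?R \<inter> colours_at E c (f p)) \<le> card ?R"
        using finB by (intro card_mono) auto
      also have "\<dots> \<le> card ?B" using finB by (intro card_image_le) auto
      also have "\<dots> < d"
        using lt A less.prems card_mono[of A B] by linarith
      also have "d = card (colours_at E c (f p))"
        using card_colours_at[OF proper] H(2) f(3) pqX by simp
      finally obtain t where t: "{f p, t} \<in> E" "c {f p, t} \<notin> ?R"
        using free_colour_edge[of E ?R c "f p"] H(1) finB by auto
      have ins: "insert {p, q} ?B = B" using pq by blast
      have "rainbow_hom B E c (f(q := t))"
        using rainbow_hom_add_leaf[OF f(1) pq(4,2) t] unfolding ins .
      moreover have "t \<in> V" using H(1) t by blast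
      moreover have "l t = K q"
        using lab[OF t(1)] f(3) pqX KA[of p q] pq less.prems by auto
      ultimately show ?thesis
        using f pq by (intro exI[of _ "f(q := t)"]) auto
    qed
  qed
  then show ?thesis using A by blast
qed

text \<open>\<open>count\<close> is the edge bound for a forest with \<open>U\<close> contracted to
  one vertex. Without a leaf, every new vertex has degree at least two in \<open>B - A0\<close>;
  double counting then forces equality, so no edge of \<open>B - A0\<close> meets \<open>U\<close>,
  and \<open>B - A0\<close> itself violates the forest bound.\<close>

lemma leaf_outside_core:
  assumes fin: "finite B" "finite U" and two: "\<forall>e\<in>B. card e = 2"
    and sp: "\<And>C. C \<subseteq> B \<Longrightarrow> C \<noteq> {} \<Longrightarrow> card C < card (\<Union>C)"
    and core: "A0 \<subset> B" "\<Union>A0 \<subseteq> U"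
    and count: "card (B - A0) + card U \<le> card (U \<union> \<Union>B)"
  shows "\<exists>p q. {p, q} \<in> B - A0 \<and> p \<noteq> q \<and> q \<notin> U \<and> q \<notin> \<Union>(B - {{p, q}})"
proof (rule ccontr)
  assume no: "\<not> ?thesis"
  let ?B = "B - A0" and ?W = "\<Union>(B - A0) - U"
  have finUB: "finite (\<Union>?B)" using fin two by (intro finite_Union_card2) auto
  have "U \<union> \<Union>B = U \<union> ?W" using core by blast
  then have "card (U \<union> \<Union>B) = card U + card ?W"
    using card_Un_disjoint[of U ?W] fin finUB by auto
  then have N: "card ?B \<le> card ?W" using count by linarith
  have deg: "2 \<le> card {e\<in>?B. q \<in> e}" if q: "q \<in> ?W" for q
  proof -
    obtain e where e: "e \<in> ?B" "q \<in> e" using q by blast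
    then obtain p where p: "e = {q, p}" "p \<noteq> q" using two card2_other by (metis DiffD1)
    have eq: "e = {p, q}" using p by auto
    have "{p, q} \<in> ?B" "q \<notin> U" using e q eq by auto
    then have "q \<in> \<Union>(B - {{p, q}})" using no p(2) by blast
    then have "q \<in> \<Union>(B - {e})" unfolding eq .
    then obtain f where f: "f \<in> B" "f \<noteq> e" "q \<in> f" by blast
    then have "f \<in> ?B" using core q by blast
    then have "card {e, f} \<le> card {e\<in>?B. q \<in> e}"
      using e f fin by (intro card_mono) auto
    then show ?thesis using f by simp
  qed
  have "2 * card ?W = (\<Sum>q\<in>?W. 2)" by simp
  also have "\<dots> \<le> (\<Sum>q\<in>?W. card {e\<in>?B. q \<in> e})" using deg by (intro sum_mono)
  also have "\<dots> = (\<Sum>e\<in>?B. card (e \<inter> ?W))"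
    using fin finUB by (intro sum_card_incident) auto
  finally have lower: "2 * card ?W \<le> (\<Sum>e\<in>?B. card (e \<inter> ?W))" .
  have le2: "card (e \<inter> ?W) \<le> 2" if "e \<in> ?B" for e
  proof -
    have "card e = 2" using two that by blast
    then show ?thesis using card_mono[of e "e \<inter> ?W"] card_ge_0_finite[of e] by auto
  qed
  have sum2: "(\<Sum>e\<in>?B. 2::nat) = 2 * card ?B" by simp
  show False
  proof (cases "\<exists>e\<in>?B. e \<inter> U \<noteq> {}")
    case True
    then obtain e where e: "e \<in> ?B" "e \<inter> U \<noteq> {}" by blast
    have "card e = 2" using two e by blast
    then have "card (e \<inter> ?W) < card e"
      using e by (intro psubset_card_mono) (auto simp: card_ge_0_finite)
    then have "(\<Sum>e\<in>?B. card (e \<inter> ?W)) < (\<Sum>e\<in>?B. 2)"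
      using e fin le2 \<open>card e = 2\<close> by (intro sum_strict_mono_ex1) auto
    then show False using lower N sum2 by linarith
  next
    case False
    then have "?W = \<Union>?B" by blast
    moreover have "card ?B < card (\<Union>?B)" using sp[of ?B] core by blast
    moreover have "(\<Sum>e\<in>?B. card (e \<inter> ?W)) \<le> (\<Sum>e\<in>?B. 2)" using le2 by (intro sum_mono)
    ultimately show False using lower sum2 by simp
  qed
qed

section \<open>Disjoint copies of a host graph\<close>

definition copies_edges :: "'i set \<Rightarrow> 'b set set \<Rightarrow> ('i \<times> 'b) set set" where
  "copies_edges I E = (\<Union>i\<in>I. (`) (Pair i) ` E)"

lemma Pair_image_eq:
  assumes "Pair i ` e = Pair j ` f" "e \<noteq> {}"
  shows "i = j \<and> e = f"
proof -
  obtain x where "x \<in> e" using assms(2) by blast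
  then have "(i, x) \<in> Pair j ` f" using assms(1) by blast
  then have "i = j" by blast
  moreover have "Pair j ` e = Pair j ` f \<longleftrightarrow> e = f"
    by (rule inj_image_eq_iff) (auto intro: injI)
  ultimately show ?thesis using assms(1) by blast
qed

lemma copies_edge_label:
  assumes "{a, b} \<in> copies_edges I E"
  shows "fst a = fst b"
proof -
  obtain i e where "{a, b} = Pair i ` e" using assms unfolding copies_edges_def by auto
  then have "a \<in> Pair i ` e" "b \<in> Pair i ` e" by blast+
  then show ?thesis by auto
qed

lemma copies_edgeI:
  assumes "i \<in> I" "{a, b} \<in> E"
  shows "{(i, a), (i, b)} \<in> copies_edges I E"
proof -
  have "Pair i ` {a, b} \<in> copies_edges I E" using assms unfolding copies_edges_def by blast
  then show ?thesis by simp
qed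

lemma copies_simple:
  assumes "\<forall>e\<in>E. e \<subseteq> V \<and> card e = 2"
  shows "\<forall>e\<in>copies_edges I E. e \<subseteq> I \<times> V \<and> card e = 2"
  using assms unfolding copies_edges_def by (auto simp: card_image inj_on_def)

lemma copies_edges_at:
  assumes "i \<in> I"
  shows "{e\<in>copies_edges I E. (i, a) \<in> e} = (`) (Pair i) ` {e\<in>E. a \<in> e}"
  using assms unfolding copies_edges_def by (auto simp: image_iff)

lemma inj_image_Pair: "inj_on ((`) (Pair i)) A"
  by (intro inj_on_image inj_onI) simp

lemma copies_degree:
  assumes "i \<in> I"
  shows "card {e\<in>copies_edges I E. (i, a) \<in> e} = card {e\<in>E. a \<in> e}"
  unfolding copies_edges_at[OF assms] by (rule card_image[OF inj_image_Pair])

lemma copies_colours_at: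
  assumes "i \<in> I"
  shows "colours_at (copies_edges I E) c (i, a) = colours_at E (\<lambda>e. c (Pair i ` e)) a"
  unfolding colours_at_def copies_edges_at[OF assms] by (simp add: image_image)

lemma copies_proper:
  assumes "proper_edge_colouring (W, copies_edges I E) c" "i \<in> I"
  shows "proper_edge_colouring (V, E) (\<lambda>e. c (Pair i ` e))"
  unfolding proper_edge_colouring_def
proof (intro ballI impI)
  fix e f assume ef: "e \<in> edges (V, E)" "f \<in> edges (V, E)" "e \<noteq> f \<and> e \<inter> f \<noteq> {}"
  have "Pair i ` e \<in> copies_edges I E" "Pair i ` f \<in> copies_edges I E"
    using ef assms(2) by (auto simp: copies_edges_def)
  moreover have "Pair i ` e \<noteq> Pair i ` f" using ef Pair_image_eq[of i e i f] by blast
  moreover have "Pair i ` e \<inter> Pair i ` f \<noteq> {}" using ef by blast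
  ultimately show "c (Pair i ` e) \<noteq> c (Pair i ` f)"
    using assms(1) unfolding proper_edge_colouring_def by simp
qed

text \<open>A rainbow homomorphism does not identify edges, so on a component with \<open>m\<close> edges, hence at
  most \<open>m + 1\<close> vertices, its image has \<open>m\<close> edges and by sparsity at least \<open>m + 1\<close> vertices.\<close>

lemma rainbow_hom_inj:
  assumes fin: "finite A" and two: "\<forall>e\<in>A. card e = 2" and sp: "sparse L E" "card A \<le> L"
    and f: "rainbow_hom A (copies_edges I E) c f" and lab: "\<forall>v\<in>X. fst (f v) = reach A v"
  shows "inj_on f X"
proof (rule inj_onI)
  fix x y assume xy: "x \<in> X" "y \<in> X" "f x = f y"
  let ?K = "reach A x"
  \<comment> \<open>Equal images lie in the same copy, and copies are labelled by
    components.\<close>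
  have K: "?K = reach A y" using lab xy by metis
  then have yK: "y \<in> ?K" using reach_refl by metis
  have finK: "finite ?K" by (rule finite_reach[OF fin bspec[OF two]])
  let ?B = "{e\<in>A. e \<subseteq> ?K}"
  show "x = y"
  proof (cases "?B = {}")
    case True
    then have "card ?B = 0" by (simp only: card.empty)
    then have "card ?K \<le> 1" using card_reach_le[OF fin bspec[OF two], of x] by linarith
    then show ?thesis using yK reach_refl[of x A] finK by (metis One_nat_def card_le_Suc0_iff_eq)
  next
    case False
    have edge: "f ` e \<in> copies_edges I E" if "e \<in> ?B" for e
      using f that by (auto simp: rainbow_hom_def)
    have fstK: "fst (f v) = fst (f x)" if "v \<in> ?K" for v
      using that
    proof (induction rule: reach_induct)
      case (step a b)
      have "f ` {a, b} \<in> copies_edges I E" using f step by (auto simp: rainbow_hom_def)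
      then have "fst (f a) = fst (f b)" using copies_edge_label[of "f a" "f b"] by simp
      then show ?case using step by simp
    qed simp
    define i where "i = fst (f x)"
    let ?g = "\<lambda>v. snd (f v)"
    have fg: "f ` e = Pair i ` ?g ` e" if "e \<in> ?B" for e
    proof -
      have "f v = (i, ?g v)" if "v \<in> e" for v
        using fstK[of v] that \<open>e \<in> ?B\<close> unfolding i_def by (metis (no_types, lifting) mem_Collect_eq prod.collapse subsetD)
      then show ?thesis by (simp add: image_image)
    qed
    let ?C = "(`) ?g ` ?B"
    have CE: "?C \<subseteq> E"
    proof
      fix e' assume "e' \<in> ?C"
      then obtain e where e: "e \<in> ?B" "e' = ?g ` e" by blast
      then have "e \<noteq> {}" using two by auto
      then have ne: "?g ` e \<noteq> {}" by blast
      obtain j e'' where "Pair i ` ?g ` e = Pair j ` e''" "e'' \<in> E"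
        using edge[OF e(1)] fg[OF e(1)] unfolding copies_edges_def by auto
      then show "e' \<in> E" using Pair_image_eq[of i "?g ` e" j e''] ne e(2) by simp
    qed
    have inj: "inj_on ((`) ?g) ?B"
    proof (rule inj_onI)
      fix e1 e2 assume e: "e1 \<in> ?B" "e2 \<in> ?B" "?g ` e1 = ?g ` e2"
      then have "f ` e1 = f ` e2" using fg by simp
      moreover have "e1 \<in> A" "e2 \<in> A" using e by auto
      ultimately show "e1 = e2" using f unfolding rainbow_hom_def inj_on_def by metis
    qed
    have "card ?B \<le> L" using sp(2) card_mono[OF fin, of ?B] by auto
    then have "finite ?C \<and> ?C \<noteq> {} \<and> card ?C \<le> L"
      using False fin by (simp only: card_image[OF inj]) simp
    then have "card ?C < card (\<Union>?C)"
      using sp(1) CE unfolding sparse_def by blast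
    also have "\<dots> \<le> card (?g ` ?K)" using finK by (intro card_mono) auto
    finally have "card ?B < card (?g ` ?K)" by (simp add: card_image[OF inj])
    then have "card ?K \<le> card (?g ` ?K)"
      using card_reach_le[OF fin bspec[OF two], of x] by linarith
    then have "card (?g ` ?K) = card ?K" using card_image_le[OF finK, of ?g] by linarith
    then have "inj_on ?g ?K" using finK eq_card_imp_inj_on by blast
    then show ?thesis using xy yK reach_refl[of x A] unfolding inj_on_def by metis
  qed
qed

text \<open>The last property expresses that \<open>d\<close> colours do not suffice: if colour sets
  agreed along all edges, each component would use just \<open>d\<close> colours, which could be
  renamed to a common palette.\<close>

lemma class_two_graph_exists:
  assumes "2 \<le> d"
  obtains V :: "(bool + nat \<times> (nat list \<Rightarrow> nat list)) set" and E where
    "finite V" "V \<noteq> {}" "\<forall>e\<in>E. e \<subseteq> V \<and> card e = 2" "\<forall>a\<in>V. card {e\<in>E. a \<in> e} = d" "sparse L E"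
    "\<forall>c :: _ \<Rightarrow> nat. proper_edge_colouring (V, E) c \<longrightarrow>
       (\<exists>a b. {a, b} \<in> E \<and> colours_at E c a \<noteq> colours_at E c b)"
proof -
  obtain V :: "(nat list \<Rightarrow> nat list) set" and E where
    VE: "finite V" "V \<noteq> {}" "\<And>e. e \<in> E \<Longrightarrow> e \<subseteq> V \<and> card e = 2"
    "\<And>v. v \<in> V \<Longrightarrow> card {e\<in>E. v \<in> e} = d" "sparse (Suc L) E"
    "0 < d \<Longrightarrow> \<exists>h. \<forall>v\<in>V. {v, h v} \<in> E \<and> h v \<noteq> v \<and> h (h v) = v"
    \<comment> \<open>The argument \<open>Suc L\<close> makes the construction applicable for
      \<open>L = 0\<close> too.\<close>
    using regular_sparse_graph_exists[of "Suc L" d] by auto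
  obtain h where h: "\<forall>v\<in>V. {v, h v} \<in> E \<and> h v \<noteq> v \<and> h (h v) = v" using VE(6) assms by auto
  obtain u where "u \<in> V" using VE(2) by blast
  then have uv: "{u, h u} \<in> E" using h by blast
  have VE': "\<forall>e\<in>E. e \<subseteq> V \<and> card e = 2" "\<forall>p\<in>V. card {e\<in>E. p \<in> e} = d" using VE(3,4) by auto
  have sp: "sparse L E" using VE(5) unfolding sparse_def by simp
  note G = VE(1) VE' sp h uv assms
  show thesis
  proof (rule that[of "gadget_verts d V" "gadget_edges d E u (h u)"])
    show "finite (gadget_verts d V)" using VE(1) by (simp add: gadget_verts_def)
    show "gadget_verts d V \<noteq> {}" by (auto simp: gadget_verts_def)
    show "\<forall>e\<in>gadget_edges d E u (h u). e \<subseteq> gadget_verts d V \<and> card e = 2"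
      using gadget_simple[OF G] by blast
    show "\<forall>a\<in>gadget_verts d V. card {e\<in>gadget_edges d E u (h u). a \<in> e} = d"
      using gadget_degree[OF G] by blast
    show "sparse L (gadget_edges d E u (h u))" by (rule gadget_sparse[OF G])
    show "\<forall>c :: _ \<Rightarrow> nat. proper_edge_colouring (gadget_verts d V, gadget_edges d E u (h u)) c \<longrightarrow>
      (\<exists>a b. {a, b} \<in> gadget_edges d E u (h u) \<and>
        colours_at (gadget_edges d E u (h u)) c a \<noteq> colours_at (gadget_edges d E u (h u)) c b)"
      unfolding colours_at_def using gadget_colour_sets_differ[OF G] by blast
  qed
qed

text \<open>The two cases differ in the core \<open>A0\<close> embedded in advance: a path
  \<open>y\<close>, \<open>x\<close>, \<open>w\<close>, or a single edge \<open>xw\<close> in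
  another component. In the second case \<open>y\<close> belongs to \<open>U\<close> although no
  core edge contains it, since its image must be fixed before a colour absent there can be
  chosen.\<close>

lemma forest_rainbow_hom:
  fixes c :: "('a set \<times> 'b) set \<Rightarrow> nat"
  assumes fin: "finite E" and two: "\<forall>e\<in>E. card e = 2"
    and sp: "\<And>C. C \<subseteq> E \<Longrightarrow> C \<noteq> {} \<Longrightarrow> card C < card (\<Union>C)"
    and EX: "\<Union>E \<subseteq> X" and d: "card E = Suc d"
    and yz: "{y, z} \<in> E" "y \<noteq> z" "z \<notin> \<Union>(E - {{y, z}})" and nonstar: "\<exists>e\<in>E. y \<notin> e"
    and V0: "V0 \<noteq> {}" and E0: "\<forall>e\<in>E0. e \<subseteq> V0 \<and> card e = 2" "\<forall>a\<in>V0. card {e\<in>E0. a \<in> e} = d"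
    and differ: "\<forall>c :: _ \<Rightarrow> nat. proper_edge_colouring (V0, E0) c \<longrightarrow>
       (\<exists>a b. {a, b} \<in> E0 \<and> colours_at E0 c a \<noteq> colours_at E0 c b)"
    and I: "I = reach E ` X" and proper: "proper_edge_colouring (I \<times> V0, copies_edges I E0) c"
  shows "\<exists>f. rainbow_hom E (copies_edges I E0) c f \<and> (\<forall>v\<in>X. f v \<in> I \<times> V0 \<and> fst (f v) = reach E v)"
proof -
  let ?G = "copies_edges I E0"
  define A where "A = E - {{y, z}}"
  have AE: "A \<subseteq> E" and finA: "finite A" and cardA: "card A = d"
    using fin yz(1) d by (auto simp: A_def)
  have insA: "insert {y, z} A = E" using yz by (auto simp: A_def)
  have zA: "z \<notin> \<Union>A" using yz by (simp add: A_def)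
  have yX: "y \<in> X" using yz EX by auto
  have IX: "reach E v \<in> I" if "v \<in> X" for v using I that by simp
  have G: "\<forall>e\<in>?G. e \<subseteq> I \<times> V0 \<and> card e = 2" using E0(1) by (rule copies_simple)
  have regG: "\<forall>a\<in>I \<times> V0. card {e\<in>?G. a \<in> e} = d" using E0(2) copies_degree by fastforce
  have cardS: "card (colours_at ?G c a) = d" if "a \<in> I \<times> V0" for a
    unfolding card_colours_at[OF proper] using regG that by blast
  have finS: "finite (colours_at ?G c a)" if "a \<in> I \<times> V0" for a
  \<comment> \<open>Finiteness is read off from a positive cardinality, as infinite sets have
    \<open>card\<close> zero. If \<open>d = 0\<close>, then \<open>{y, z}\<close> is the only edge,
    against \<open>nonstar\<close>.\<close>
  proof (cases "d = 0")
    case True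
    then have "A = {}" using cardA finA by simp
    then show ?thesis using nonstar insA by auto
  next
    case False then show ?thesis using cardS[OF that] by (simp add: card_ge_0_finite)
  qed
  txt \<open>Once a colour missing at the image of \<open>y\<close> has been used, at most \<open>d - 1\<close> of the \<open>d\<close> colours
    there are spent before the last edge \<open>{y, z}\<close> is embedded.\<close>
  have finish: ?thesis if A0: "A0 \<subseteq> A" and U: "\<Union>A0 \<subseteq> U" "finite U" "y \<in> U"
    and count: "\<And>B. A0 \<subseteq> B \<Longrightarrow> B \<subseteq> A \<Longrightarrow> card (B - A0) + card U \<le> card (U \<union> \<Union>B)"
    and f0: "rainbow_hom A0 ?G c f0" "\<forall>v\<in>X. f0 v \<in> I \<times> V0 \<and> fst (f0 v) = reach E v"
    and e0: "e0 \<in> A0" "c (f0 ` e0) \<notin> colours_at ?G c (f0 y)" for A0 U f0 e0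
  proof -
    have leaf: "\<exists>p q. {p, q} \<in> B - A0 \<and> p \<noteq> q \<and> q \<notin> U \<and> q \<notin> \<Union>(B - {{p, q}})"
      if B: "A0 \<subset> B" "B \<subseteq> A" for B
    proof (rule leaf_outside_core[OF _ U(2) _ _ B(1) U(1)])
      show "finite B" using B finA finite_subset by blast
      show "\<forall>e\<in>B. card e = 2" using B AE two by blast
      show "card C < card (\<Union>C)" if "C \<subseteq> B" "C \<noteq> {}" for C using sp[of C] that B AE by blast
      show "card (B - A0) + card U \<le> card (U \<union> \<Union>B)" using count[of B] B by blast
    qed
    have "\<exists>f. rainbow_hom A ?G c f \<and> (\<forall>v\<in>U. f v = f0 v) \<and> (\<forall>v\<in>X. f v \<in> I \<times> V0 \<and> fst (f v) = reach E v)"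
    proof (rule greedy_rainbow_hom[OF G regG _ proper f0 _ _ leaf A0 finA])
      show "fst a = fst b" if "{a, b} \<in> ?G" for a b using that by (rule copies_edge_label)
      show "reach E p = reach E q" if "{p, q} \<in> A" for p q using that AE by (intro reach_edge_eq) blast
      show "\<Union>A \<subseteq> X" using AE EX by blast
      show "card A \<le> d" using cardA by simp
    qed
    then obtain f where f: "rainbow_hom A ?G c f" "\<forall>v\<in>U. f v = f0 v"
      "\<forall>v\<in>X. f v \<in> I \<times> V0 \<and> fst (f v) = reach E v" by blast
    have fy: "f y = f0 y" using f U by blast
    let ?R = "(\<lambda>e. c (f ` e)) ` A" and ?S = "colours_at ?G c (f y)"
    have "f ` e0 = f0 ` e0" using f(2) U e0(1) by (intro image_cong) auto
    then have "c (f ` e0) \<in> ?R - ?S" using A0 e0 fy by (auto intro: image_eqI[of _ _ e0])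
    then have "card (?R \<inter> ?S) < card ?R" using finA by (intro psubset_card_mono) auto
    also have "\<dots> \<le> d" using card_image_le[OF finA] cardA by metis
    also have "d = card ?S" using cardS f(3) yX by simp
    finally obtain t where t: "{f y, t} \<in> ?G" "c {f y, t} \<notin> ?R"
      using free_colour_edge[of ?G ?R c "f y"] G finA by auto
    have "rainbow_hom E ?G c (f(z := t))"
      using rainbow_hom_add_leaf[OF f(1) zA yz(2) t] unfolding insA .
    moreover have "t \<in> I \<times> V0" using G t by blast
    moreover have "fst t = reach E z"
      using copies_edge_label[OF t(1)] f(3) yX reach_edge_eq[OF yz(1)] by simp
    ultimately show ?thesis using f(3) by (intro exI[of _ "f(z := t)"]) auto
  qed
  show ?thesis
  proof (cases "\<exists>x w. {x, w} \<in> E \<and> y \<noteq> x \<and> y \<noteq> w \<and> {y, x} \<in> E")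
    case True
    then obtain x w where xw: "{x, w} \<in> E" "y \<noteq> x" "y \<noteq> w" "{y, x} \<in> E" by blast
    have "x \<noteq> w" using two xw(1) by fastforce
    have "{x, w} \<in> A" using xw by (auto simp: A_def doubleton_eq_iff)
    then have "x \<noteq> z" using zA by auto
    then have "{y, x} \<in> A" using xw by (auto simp: A_def doubleton_eq_iff)
    let ?A0 = "{{y, x}, {x, w}}" and ?U = "{y, x, w}" and ?i = "reach E y"
    have ne: "{y, x} \<noteq> {x, w}" using xw by (auto simp: doubleton_eq_iff)
    have i: "?i \<in> I" using IX yX by blast
    have lab: "reach E x = ?i" "reach E w = ?i"
      using reach_edge_eq[OF xw(4)] reach_edge_eq[OF xw(1)] by simp_all
    obtain a b where ab: "{a, b} \<in> E0" "colours_at ?G c (?i, a) \<noteq> colours_at ?G c (?i, b)"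
      using differ[rule_format, OF copies_proper[OF proper i]] unfolding copies_colours_at[OF i] by blast
    have abV: "a \<in> V0" "b \<in> V0" using E0 ab by auto
    \<comment> \<open>Different sets of the same size \<open>d\<close> are incomparable.\<close>
    have "\<not> colours_at ?G c (?i, b) \<subseteq> colours_at ?G c (?i, a)"
      using card_subset_eq[OF finS, of "(?i, a)" "colours_at ?G c (?i, b)"] cardS abV i ab(2) by auto
    then obtain e where e: "e \<in> ?G" "(?i, b) \<in> e" "c e \<notin> colours_at ?G c (?i, a)"
      unfolding colours_at_def[of _ _ "(?i, b)"] by auto
    then obtain t' where t': "e = {(?i, b), t'}" using G card2_other by metis
    have "fst t' = ?i" using copies_edge_label[of "(?i, b)" t'] e t' by simp
    then obtain t where t: "e = {(?i, b), (?i, t)}" using t' by (cases t') auto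
    have tV: "t \<in> V0" using G e t by auto
    \<comment> \<open>Vertices off the core get the placeholder \<open>a\<close> in the copy of
      their own component, so that the labels are already right.\<close>
    define f0 where "f0 = (\<lambda>v. (reach E v, if v = y then a else if v = x then b else if v = w then t else a))"
    have im: "f0 ` {y, x} = {(?i, a), (?i, b)}" "f0 ` {x, w} = e"
      using xw \<open>x \<noteq> w\<close> lab t by (auto simp: f0_def)
    have abG: "{(?i, a), (?i, b)} \<in> ?G" using copies_edgeI[OF i ab(1)] .
    then have "c {(?i, a), (?i, b)} \<in> colours_at ?G c (?i, a)" unfolding colours_at_def by blast
    then have "rainbow_hom ?A0 ?G c f0"
      using im abG e unfolding rainbow_hom_def by (auto simp: inj_on_def)
    moreover have "\<forall>v\<in>X. f0 v \<in> I \<times> V0 \<and> fst (f0 v) = reach E v"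
      using abV tV IX by (auto simp: f0_def)
    moreover have "c (f0 ` {x, w}) \<notin> colours_at ?G c (f0 y)"
      using im e by (simp add: f0_def)
    \<comment> \<open>The core has two edges and three vertices, so this is the forest bound for
      \<open>B\<close>.\<close>
    moreover have "card (B - ?A0) + card ?U \<le> card (?U \<union> \<Union>B)" if B: "?A0 \<subseteq> B" "B \<subseteq> A" for B
    proof -
      have "finite B" using B finA finite_subset by blast
      then have "card (B - ?A0) = card B - 2" "2 \<le> card B"
        using card_Diff_subset[of ?A0 B] card_mono[of B ?A0] B ne by auto
      moreover have "?U \<union> \<Union>B = \<Union>B" using B by auto
      moreover have "card B < card (\<Union>B)" using sp[of B] B AE by auto
      moreover have "card ?U = 3" using xw \<open>x \<noteq> w\<close> by simp
      ultimately show ?thesis by simp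
    qed
    ultimately show ?thesis
      using finish[of ?A0 ?U f0 "{x, w}"] \<open>{y, x} \<in> A\<close> \<open>{x, w} \<in> A\<close> by blast
  next
    case False
    obtain e where "e \<in> E" "y \<notin> e" using nonstar by blast
    then obtain x w where xw: "{x, w} \<in> E" "y \<noteq> x" "y \<noteq> w" "x \<noteq> w"
      using two by (metis card_2_iff insertI1 insertI2)
    let ?K = "reach E y" and ?A0 = "{{x, w}}" and ?U = "{y, x, w}" and ?j = "reach E x"
    have star: "v = y \<or> {y, v} \<in> E" if "v \<in> ?K" for v
      using that
    proof (induction rule: reach_induct)
      case (step p q)
      then show ?case using False by (metis insert_commute)
    qed simp
    have "{y, x} \<notin> E" using False xw by blast
    then have xK: "x \<notin> ?K" using star[of x] xw by blast
    have xwA: "{x, w} \<in> A" using xw by (auto simp: A_def doubleton_eq_iff)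
    have xX: "x \<in> X" using xw EX by auto
    have i: "?K \<in> I" "?j \<in> I" using IX yX xX by auto
    have lab: "reach E w = ?j" using reach_edge_eq[OF xw(1)] by simp
    obtain a where a: "a \<in> V0" using V0 by blast
    let ?S = "colours_at ?G c (?K, a)"
    obtain b1 b2 where b: "{b1, b2} \<in> E0" "colours_at ?G c (?j, b1) \<noteq> colours_at ?G c (?j, b2)"
      using differ[rule_format, OF copies_proper[OF proper i(2)]] unfolding copies_colours_at[OF i(2)] by blast
    have bV: "b1 \<in> V0" "b2 \<in> V0" using E0 b by auto
    \<comment> \<open>The only colour set contained in \<open>?S\<close> is \<open>?S\<close>
      itself, and copy \<open>?j\<close> has two different colour sets; so one of them is not
      contained in \<open>?S\<close>.\<close>
    have eqS: "colours_at ?G c (?j, b) = ?S" if "colours_at ?G c (?j, b) \<subseteq> ?S" "b \<in> V0" for b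
      using card_subset_eq[OF finS that(1)] cardS a i that by auto
    obtain b where b: "b \<in> V0" "\<not> colours_at ?G c (?j, b) \<subseteq> ?S"
      using eqS b bV by metis
    then obtain e where e: "e \<in> ?G" "(?j, b) \<in> e" "c e \<notin> ?S"
      unfolding colours_at_def[of _ _ "(?j, b)"] by auto
    then obtain t' where t': "e = {(?j, b), t'}" using G card2_other by metis
    have "fst t' = ?j" using copies_edge_label[of "(?j, b)" t'] e t' by simp
    then obtain t where t: "e = {(?j, b), (?j, t)}" using t' by (cases t') auto
    have tV: "t \<in> V0" using G e t by auto
    define f0 where "f0 = (\<lambda>v. (reach E v, if v = x then b else if v = w then t else a))"
    have im: "f0 ` {x, w} = e" using xw lab t by (auto simp: f0_def)
    have "rainbow_hom ?A0 ?G c f0"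
      using im e unfolding rainbow_hom_def by simp
    moreover have "\<forall>v\<in>X. f0 v \<in> I \<times> V0 \<and> fst (f0 v) = reach E v"
      using a b(1) tV IX by (auto simp: f0_def)
    moreover have "c (f0 ` {x, w}) \<notin> colours_at ?G c (f0 y)"
      using im e xw by (simp add: f0_def)
    moreover have "card (B - ?A0) + card ?U \<le> card (?U \<union> \<Union>B)" if B: "?A0 \<subseteq> B" "B \<subseteq> A" for B
    proof -
      have finB: "finite B" using B finA finite_subset by blast
      have BE: "B \<subseteq> E" using B AE by blast
      have finUB: "finite (\<Union>B)" using finB BE two by (intro finite_Union_card2) auto
      \<comment> \<open>With one core edge and three vertices in \<open>?U\<close>, two more
        vertices than edges are needed. One surplus vertex comes from the component of
        \<open>y\<close>, where \<open>y\<close> itself counts even if \<open>?B1\<close> is empty,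
        and one from the rest, which contains \<open>{x, w}\<close>.\<close>
      let ?B1 = "{e\<in>B. e \<subseteq> ?K}" and ?B2 = "{e\<in>B. \<not> e \<subseteq> ?K}"
      have finU12: "finite (\<Union>?B1)" "finite (\<Union>?B2)"
        by (rule finite_subset[OF _ finUB], blast)+
      have B2: "e \<inter> ?K = {}" if "e \<in> ?B2" for e
      proof (rule ccontr)
        assume "e \<inter> ?K \<noteq> {}"
        then obtain p where p: "p \<in> e" "p \<in> ?K" by blast
        have "card e = 2" using that BE two by blast
        then obtain q where "e = {p, q}" using p card2_other by metis
        then show False using that p reach_step[of p E y q] BE by auto
      qed
      have "?B1 \<union> ?B2 = B" by blast
      then have "card B = card ?B1 + card ?B2"
        using finB by (subst card_Un_disjoint[symmetric]) auto
      moreover have "Suc (card ?B1) \<le> card (insert y (\<Union>?B1))"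
      proof (cases "?B1 = {}")
        case True
        then have "card ?B1 = 0" by (simp only: card.empty)
        moreover have "0 < card (insert y (\<Union>?B1))" unfolding True by simp
        ultimately show ?thesis by linarith
      next
        case False
        then have "card ?B1 < card (\<Union>?B1)" using sp[of ?B1] BE by blast
        also have "\<dots> \<le> card (insert y (\<Union>?B1))"
          using finU12 by (intro card_mono) auto
        finally show ?thesis by simp
      qed
      moreover have "{x, w} \<in> ?B2" using B xK by auto
      then have "card ?B2 < card (\<Union>?B2)" using sp[of ?B2] BE by blast
      moreover have "insert y (\<Union>?B1) \<inter> \<Union>?B2 = {}" using B2 reach_refl[of y E] by blast
      then have "card (insert y (\<Union>?B1) \<union> \<Union>?B2) = card (insert y (\<Union>?B1)) + card (\<Union>?B2)"
        using finU12 by (intro card_Un_disjoint) auto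
      moreover have "card (insert y (\<Union>?B1) \<union> \<Union>?B2) \<le> card (?U \<union> \<Union>B)"
        using finUB by (intro card_mono) auto
      moreover have "card (B - ?A0) = card B - 1" "1 \<le> card B"
        using card_Diff_subset[of ?A0 B] card_mono[of B ?A0] B finB by auto
      moreover have "card ?U = 3" using xw by simp
      ultimately show ?thesis by linarith
    qed
    ultimately show ?thesis
      using finish[of ?A0 ?U f0 "{x, w}"] xwA by blast
  qed
qed

section \<open>Degree anti-Ramsey numbers\<close>

lemma has_rainbow_copy_iff:
  assumes F: "simple_graph F"
  shows "has_rainbow_copy F G c \<longleftrightarrow>
    (\<exists>f. inj_on f (verts F) \<and> f ` verts F \<subseteq> verts G \<and> rainbow_hom (edges F) (edges G) c f)"
proof
  assume "has_rainbow_copy F G c"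
  then obtain H f where H: "subgraph H G" "rainbow c H" and f: "bij_betw f (verts F) (verts H)"
    "edges H = (\<lambda>e. f ` e) ` edges F"
    unfolding has_rainbow_copy_def isomorphic_def by blast
  have inj: "inj_on f (verts F)" using f by (simp add: bij_betw_def)
  have "inj_on ((`) f) (edges F)"
    using inj F by (intro inj_onI) (metis inj_on_image_eq_iff simple_graph_def)
  then have "inj_on (c \<circ> (`) f) (edges F)"
    using H(2) f(2) unfolding rainbow_def by (intro comp_inj_on) simp_all
  then have "rainbow_hom (edges F) (edges G) c f"
    using H(1) f(2) unfolding rainbow_hom_def subgraph_def comp_def by blast
  then show "\<exists>f. inj_on f (verts F) \<and> f ` verts F \<subseteq> verts G \<and> rainbow_hom (edges F) (edges G) c f"
    using inj f(1) H(1) unfolding bij_betw_def subgraph_def by blast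
next
  assume "\<exists>f. inj_on f (verts F) \<and> f ` verts F \<subseteq> verts G \<and> rainbow_hom (edges F) (edges G) c f"
  then obtain f where f: "inj_on f (verts F)" "f ` verts F \<subseteq> verts G" "rainbow_hom (edges F) (edges G) c f"
    by blast
  let ?H = "(f ` verts F, (`) f ` edges F)"
  have "card (f ` e) = 2" if "e \<in> edges F" for e
    using that F f(1) by (metis card_image inj_on_subset simple_graph_def)
  then have "simple_graph ?H" using F unfolding simple_graph_def by auto
  then have "subgraph ?H G" using f(2,3) unfolding subgraph_def rainbow_hom_def by auto
  moreover have "isomorphic F ?H" using f(1) unfolding isomorphic_def by (auto simp: bij_betw_def)
  moreover have "inj_on c ((`) f ` edges F)"
    using f(3) unfolding rainbow_hom_def by (auto simp: inj_on_def)
  then have "rainbow c ?H" by (simp add: rainbow_def)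
  ultimately show "has_rainbow_copy F G c" unfolding has_rainbow_copy_def by blast
qed

definition forces_rainbow :: "'a ugraph \<Rightarrow> nat \<Rightarrow> 'b ugraph \<Rightarrow> bool" where
  "forces_rainbow F k G \<longleftrightarrow> simple_graph G \<and> max_degree_le G k \<and>
     (\<forall>c :: 'b set \<Rightarrow> nat. proper_edge_colouring G c \<longrightarrow> has_rainbow_copy F G c)"

lemma simple_graph_edges:
  assumes "simple_graph G"
  shows "finite (edges G)" "\<forall>e\<in>edges G. card e = 2" "\<Union>(edges G) \<subseteq> verts G"
proof -
  have "edges G \<subseteq> Pow (verts G)" "finite (verts G)" using assms by (auto simp: simple_graph_def)
  then show "finite (edges G)" by (meson finite_Pow_iff finite_subset)
qed (use assms in \<open>auto simp: simple_graph_def\<close>)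

text \<open>\<open>AR_d\<close> ranges over hosts on natural numbers, whereas the hosts built here
  have structured vertex types.\<close>

lemma forces_rainbow_nat:
  fixes G :: "'b ugraph"
  assumes F: "simple_graph F" and G: "forces_rainbow F k G"
  shows "\<exists>G' :: nat ugraph. forces_rainbow F k G'"
proof -
  have sG: "simple_graph G" using G by (simp add: forces_rainbow_def)
  then have "finite (verts G)" by (simp add: simple_graph_def)
  then obtain g :: "'b \<Rightarrow> nat" where g: "inj_on g (verts G)" using finite_imp_inj_to_nat_seg by metis
  have sub: "e \<subseteq> verts G" if "e \<in> edges G" for e using sG that by (auto simp: simple_graph_def)
  let ?G = "(g ` verts G, (`) g ` edges G)"
  have "card (g ` e) = 2" if "e \<in> edges G" for e
    using that sG g by (metis card_image inj_on_subset simple_graph_def)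
  then have "simple_graph ?G" using sG unfolding simple_graph_def by auto
  moreover have "max_degree_le ?G k"
    unfolding max_degree_le_def
  proof
    fix w assume "w \<in> verts ?G"
    then obtain v where v: "v \<in> verts G" "w = g v" by auto
    have "v \<in> e" if "e \<in> edges G" "g v \<in> g ` e" for e
      using that sub[of e] v g by (metis inj_on_image_mem_iff)
    then have "{e\<in>edges ?G. w \<in> e} \<subseteq> (`) g ` {e\<in>edges G. v \<in> e}" using v by auto
    then have "card {e\<in>edges ?G. w \<in> e} \<le> card ((`) g ` {e\<in>edges G. v \<in> e})"
      using simple_graph_edges(1)[OF sG] by (intro card_mono) auto
    also have "\<dots> \<le> card {e\<in>edges G. v \<in> e}"
      using simple_graph_edges(1)[OF sG] by (intro card_image_le) auto
    also have "\<dots> \<le> k"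
      using G v by (auto simp: forces_rainbow_def max_degree_le_def degree_def)
    finally show "degree ?G w \<le> k" by (simp add: degree_def)
  qed
  moreover have "has_rainbow_copy F ?G c" if c: "proper_edge_colouring ?G c" for c :: "nat set \<Rightarrow> nat"
  proof -
    have "proper_edge_colouring G (\<lambda>e. c (g ` e))"
      unfolding proper_edge_colouring_def
    proof (intro ballI impI)
      fix e f assume e: "e \<in> edges G" and f: "f \<in> edges G" and ef: "e \<noteq> f \<and> e \<inter> f \<noteq> {}"
      have "g ` e \<noteq> g ` f" using inj_on_image_eq_iff[OF g sub[OF e] sub[OF f]] ef by blast
      moreover have "g ` e \<inter> g ` f \<noteq> {}" using ef by blast
      ultimately show "c (g ` e) \<noteq> c (g ` f)"
        using c e f unfolding proper_edge_colouring_def by simp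
    qed
    then have "has_rainbow_copy F G (\<lambda>e. c (g ` e))" using G by (simp add: forces_rainbow_def)
    then obtain f where f: "inj_on f (verts F)" "f ` verts F \<subseteq> verts G"
      "rainbow_hom (edges F) (edges G) (\<lambda>e. c (g ` e)) f"
      unfolding has_rainbow_copy_iff[OF F] by blast
    have "inj_on (g \<circ> f) (verts F)" using f g by (meson comp_inj_on inj_on_subset)
    moreover have "rainbow_hom (edges F) (edges ?G) c (g \<circ> f)"
      using f(3) unfolding rainbow_hom_def image_comp[symmetric] by simp
    ultimately show ?thesis
      unfolding has_rainbow_copy_iff[OF F] using f(2) by (intro exI[of _ "g \<circ> f"]) auto
  qed
  ultimately have "forces_rainbow F k ?G" by (simp add: forces_rainbow_def)
  then show ?thesis by blast
qed

lemma AR_d_eqI: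
  fixes G :: "'b ugraph"
  assumes "simple_graph F" "forces_rainbow F k G"
    and "\<And>j (G :: nat ugraph). forces_rainbow F j G \<Longrightarrow> k \<le> j"
  shows "AR_d F = k"
proof -
  have "AR_d F = (LEAST k. \<exists>G :: nat ugraph. forces_rainbow F k G)"
    by (simp add: AR_d_def forces_rainbow_def)
  also have "\<dots> = k"
    by (rule Least_equality) (use forces_rainbow_nat[OF assms(1,2)] assms(3) in blast)+
  finally show ?thesis .
qed

lemma forces_rainbow_lower_bound:
  fixes G :: "'b ugraph"
  assumes F: "simple_graph F" and G: "forces_rainbow F k G"
  shows "num_edges F - 1 \<le> k"
proof -
  have sG: "simple_graph G" using G by (simp add: forces_rainbow_def)
  have "card {e\<in>edges G. v \<in> e} \<le> k" for v
  proof (cases "v \<in> verts G")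
    case True
    then show ?thesis using G by (auto simp: forces_rainbow_def max_degree_le_def degree_def)
  next
    case False
    then have "{e\<in>edges G. v \<in> e} = {}" using sG by (auto simp: simple_graph_def)
    then show ?thesis by (simp only: card.empty)
  qed
  then obtain c where c: "edge_colouring (edges G) k c"
    using Vizing[of "edges G" k] simple_graph_edges[OF sG] by blast
  then have "proper_edge_colouring G c"
    by (auto simp: edge_colouring_def proper_edge_colouring_def)
  then have "has_rainbow_copy F G c" using G by (simp add: forces_rainbow_def)
  then obtain f where f: "rainbow_hom (edges F) (edges G) c f"
    unfolding has_rainbow_copy_iff[OF F] by blast
  then have "card (edges F) = card ((\<lambda>e. c (f ` e)) ` edges F)"
    unfolding rainbow_hom_def by (simp add: card_image)
  also have "\<dots> \<le> card {..k}"
    using f c unfolding rainbow_hom_def edge_colouring_def by (intro card_mono) auto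
  finally show ?thesis by (simp add: num_edges_def)
qed

section \<open>The exceptional cases: stars and two disjoint edges\<close>

lemma is_star_common_vertex:
  assumes "is_star (delete_isolated F)"
  obtains z where "\<forall>e\<in>edges F. z \<in> e"
  using assms unfolding is_star_def delete_isolated_def by auto

lemma is_starI:
  assumes F: "simple_graph F" and ne: "edges F \<noteq> {}" and y: "\<forall>e\<in>edges F. y \<in> e"
  shows "is_star (delete_isolated F)"
proof -
  let ?L = "{x. {y, x} \<in> edges F}"
  have e: "\<exists>x. e = {y, x} \<and> x \<noteq> y" if "e \<in> edges F" for e
    using card2_other[of e y] simple_graph_edges(2)[OF F] y that by metis
  have "?L \<subseteq> verts F" using simple_graph_edges(3)[OF F] by auto
  then have "finite ?L" using F finite_subset by (auto simp: simple_graph_def)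
  moreover have "y \<notin> ?L" using simple_graph_edges(2)[OF F] by fastforce
  moreover have "?L \<noteq> {}" using ne e by blast
  moreover have im: "edges F = (\<lambda>x. {y, x}) ` ?L" using e by auto
  moreover have "{v \<in> verts F. \<exists>e\<in>edges F. v \<in> e} = insert y ?L" (is "?l = ?r")
  proof (intro equalityI subsetI)
    fix v assume "v \<in> ?l"
    then obtain e' where "e' \<in> edges F" "v \<in> e'" by blast
    then show "v \<in> ?r" using e[of e'] by auto
  next
    fix v assume "v \<in> ?r"
    then obtain e' where "e' \<in> edges F" "v \<in> e'" using ne y by blast
    then show "v \<in> ?l" using simple_graph_edges(3)[OF F] by blast
  qed
  ultimately show ?thesis
    unfolding is_star_def delete_isolated_def fst_conv snd_conv by blast
qed

text \<open>All edges meet in one vertex, so every proper colouring makes \<open>F\<close> itself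
  rainbow. Conversely, any host must contain a vertex on at least \<open>num_edges F\<close>
  edges.\<close>

lemma AR_d_star:
  assumes F: "simple_graph F" and star: "is_star (delete_isolated F)"
  shows "AR_d F = num_edges F"
proof -
  obtain z where z: "\<forall>e\<in>edges F. z \<in> e" using star by (rule is_star_common_vertex)
  note E = simple_graph_edges[OF F]
  show ?thesis
  proof (rule AR_d_eqI[OF F])
    have "degree F v \<le> num_edges F" for v
      unfolding degree_def num_edges_def using E(1) by (intro card_mono) auto
    moreover have "has_rainbow_copy F F c" if "proper_edge_colouring F c" for c :: "'a set \<Rightarrow> nat"
    proof -
      have "inj_on c (edges F)"
        using that z unfolding proper_edge_colouring_def by (intro inj_onI) blast
      then show ?thesis
        unfolding has_rainbow_copy_iff[OF F] rainbow_hom_def by (intro exI[of _ id]) simp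
    qed
    ultimately show "forces_rainbow F (num_edges F) F"
      using F by (simp add: forces_rainbow_def max_degree_le_def)
  next
    fix j and G :: "nat ugraph" assume G: "forces_rainbow F j G"
    then have sG: "simple_graph G" by (simp add: forces_rainbow_def)
    \<comment> \<open>Giving all edges different colours is a way to extract some copy of
      \<open>F\<close> from the host.\<close>
    obtain c :: "nat set \<Rightarrow> nat" where "inj_on c (edges G)"
      using finite_imp_inj_to_nat_seg[OF simple_graph_edges(1)[OF sG]] by metis
    then have "proper_edge_colouring G c"
      unfolding proper_edge_colouring_def by (auto dest: inj_onD)
    then have "has_rainbow_copy F G c" using G by (simp add: forces_rainbow_def)
    then obtain f where f: "f ` verts F \<subseteq> verts G" "rainbow_hom (edges F) (edges G) c f"
      unfolding has_rainbow_copy_iff[OF F] by blast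
    show "num_edges F \<le> j"
    proof (cases "edges F = {}")
      case False
      then have "z \<in> verts F" using z E(3) by blast
      then have "card {e\<in>edges G. f z \<in> e} \<le> j"
        using G f(1) by (auto simp: forces_rainbow_def max_degree_le_def degree_def)
      moreover have "inj_on ((`) f) (edges F)"
        using f(2) unfolding rainbow_hom_def inj_on_def by metis
      then have "card (edges F) = card ((`) f ` edges F)" by (simp add: card_image)
      moreover have "card ((`) f ` edges F) \<le> card {e\<in>edges G. f z \<in> e}"
        using f(2) z simple_graph_edges(1)[OF sG] unfolding rainbow_hom_def
        by (intro card_mono) auto
      ultimately show ?thesis by (simp add: num_edges_def)
    qed (simp add: num_edges_def)
  qed
qed

text \<open>The host has two adjacent edges and a third edge disjoint from both: the adjacent ones
  differ in colour, so one of them differs from the third. With maximum degree at most one, a single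
  colour is already proper.\<close>

lemma AR_d_two_matching:
  assumes F: "simple_graph F" and m: "is_matching F" "num_edges F = 2"
  shows "AR_d F = 2"
proof -
  note E = simple_graph_edges[OF F]
  obtain e1 e2 where e: "edges F = {e1, e2}" "e1 \<noteq> e2" using m(2) by (auto simp: num_edges_def card_2_iff)
  obtain a b where ab: "e1 = {a, b}" "a \<noteq> b" using E(2) e by (auto simp: card_2_iff)
  obtain p q where pq: "e2 = {p, q}" "p \<noteq> q" using E(2) e by (auto simp: card_2_iff)
  have disj: "{a, b} \<inter> {p, q} = {}" using m(1) e ab pq by (auto simp: is_matching_def)
  have V: "a \<in> verts F" "b \<in> verts F" "p \<in> verts F" "q \<in> verts F" using E(3) e ab pq by auto
  let ?e1 = "{(a, False), (b, False)}" and ?e2 = "{(a, True), (b, False)}" and ?e3 = "{(p, False), (q, False)}"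
  let ?G = "(verts F \<times> UNIV, {?e1, ?e2, ?e3})"
  show ?thesis
  proof (rule AR_d_eqI[OF F])
    have "simple_graph ?G" using F V ab pq by (auto simp: simple_graph_def)
    moreover have "max_degree_le ?G 2"
      unfolding max_degree_le_def
    proof
      fix v
      have "{e\<in>edges ?G. v \<in> e} \<subseteq> {?e1, ?e2} \<or> {e\<in>edges ?G. v \<in> e} \<subseteq> {?e3}" using disj by auto
      moreover have "card {?e1, ?e2} \<le> 2" "card {?e3} \<le> 2" by (auto simp: card_insert_if)
      ultimately have "card {e\<in>edges ?G. v \<in> e} \<le> 2"
        by (meson card_mono finite.emptyI finite_insert order_trans)
      then show "degree ?G v \<le> 2" by (simp add: degree_def)
    qed
    moreover have "has_rainbow_copy F ?G c" if c: "proper_edge_colouring ?G c" for c :: "_ \<Rightarrow> nat"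
    proof -
      have "?e1 \<noteq> ?e2 \<and> ?e1 \<inter> ?e2 \<noteq> {}" by (auto simp: doubleton_eq_iff)
      then have ne: "c ?e1 \<noteq> c ?e2" using c unfolding proper_edge_colouring_def by simp
      \<comment> \<open>Keeping \<open>v\<close> as the first coordinate makes \<open>f\<close>
        injective on isolated vertices as well.\<close>
      define f where "f = (\<lambda>v. (v, v = a \<and> c ?e3 = c ?e1))"
      have f1: "f ` {a, b} = (if c ?e3 = c ?e1 then ?e2 else ?e1)" using ab by (auto simp: f_def)
      have f2: "f ` {p, q} = ?e3" using disj by (auto simp: f_def)
      have "c (f ` {a, b}) \<noteq> c (f ` {p, q})" unfolding f1 f2 using ne by auto
      moreover have "f ` {a, b} \<in> edges ?G" "f ` {p, q} \<in> edges ?G" unfolding f1 f2 by auto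
      ultimately have "rainbow_hom (edges F) (edges ?G) c f"
        unfolding e(1) ab(1) pq(1) by (intro rainbow_hom_pair)
      moreover have "inj_on f (verts F)" by (auto simp: inj_on_def f_def)
      moreover have "f ` verts F \<subseteq> verts ?G" by (auto simp: f_def)
      ultimately show ?thesis unfolding has_rainbow_copy_iff[OF F] by blast
    qed
    ultimately show "forces_rainbow F 2 ?G" by (simp only: forces_rainbow_def) blast
  next
    fix j and G :: "nat ugraph" assume G: "forces_rainbow F j G"
    then have sG: "simple_graph G" by (simp add: forces_rainbow_def)
    show "2 \<le> j"
    proof (rule ccontr)
      assume j: "\<not> 2 \<le> j"
      have "proper_edge_colouring G (\<lambda>_. 0 :: nat)"
        unfolding proper_edge_colouring_def
      proof (intro ballI impI)
        fix e f assume ef: "e \<in> edges G" "f \<in> edges G" "e \<noteq> f \<and> e \<inter> f \<noteq> {}"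
        then obtain v where v: "v \<in> e" "v \<in> f" by blast
        then have "v \<in> verts G" using ef simple_graph_edges(3)[OF sG] by blast
        then have "card {e\<in>edges G. v \<in> e} \<le> j"
          using G by (auto simp: forces_rainbow_def max_degree_le_def degree_def)
        moreover have "card {e, f} \<le> card {e\<in>edges G. v \<in> e}"
          using ef v simple_graph_edges(1)[OF sG] by (intro card_mono) auto
        ultimately show "(0::nat) \<noteq> 0" using ef j by simp
      qed
      then have "has_rainbow_copy F G (\<lambda>_. 0 :: nat)" using G by (simp add: forces_rainbow_def)
      then obtain f where "rainbow_hom (edges F) (edges G) (\<lambda>_. 0 :: nat) f"
        unfolding has_rainbow_copy_iff[OF F] by blast
      then show False using e unfolding rainbow_hom_def by (simp add: inj_on_def)
    qed
  qed
qed

section \<open>The edgeless forest and the general case\<close>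

lemma AR_d_edgeless:
  assumes F: "simple_graph F" and "edges F = {}"
  shows "AR_d F = 0"
proof (rule AR_d_eqI[OF F])
  have "has_rainbow_copy F F c" for c :: "'a set \<Rightarrow> nat"
    unfolding has_rainbow_copy_iff[OF F] rainbow_hom_def using assms by (intro exI[of _ id]) simp
  then show "forces_rainbow F 0 F"
    using assms by (simp add: forces_rainbow_def max_degree_le_def degree_def)
qed simp

lemma AR_d_forest:
  assumes forest: "forest F" and ne: "edges F \<noteq> {}"
    and nonstar: "\<not> is_star (delete_isolated F)" and nonmatching: "\<not> (is_matching F \<and> num_edges F = 2)"
  shows "AR_d F = num_edges F - 1"
proof -
  have F: "simple_graph F" and acyclic: "\<nexists>vs. is_cycle F vs" using forest by (auto simp: forest_def)
  note E = simple_graph_edges[OF F]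
  have sp: "card C < card (\<Union>C)" if C: "C \<subseteq> edges F" "C \<noteq> {}" for C
  proof -
    have "sparse (card C) (edges F)"
    proof (rule sparse_if_no_short_cycle)
      show "card e = 2" if "e \<in> edges F" for e using E(2) that by blast
      show "card C < length vs" if "is_cycle (verts F, edges F) vs" for vs using acyclic that by auto
    qed
    then show ?thesis using C E(1) finite_subset unfolding sparse_def by blast
  qed
  \<comment> \<open>With an empty core and empty \<open>U\<close>, \<open>leaf_outside_core\<close>
    yields an ordinary leaf.\<close>
  have "\<exists>p q. {p, q} \<in> edges F - {} \<and> p \<noteq> q \<and> q \<notin> {} \<and> q \<notin> \<Union>(edges F - {{p, q}})"
  proof (rule leaf_outside_core)
    show "card (edges F - {}) + card {} \<le> card ({} \<union> \<Union>(edges F))" using sp[of "edges F"] ne by simp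
  qed (use E ne sp in auto)
  then obtain y z where yz: "{y, z} \<in> edges F" "y \<noteq> z" "z \<notin> \<Union>(edges F - {{y, z}})" by blast
  have ex: "\<exists>e\<in>edges F. y \<notin> e" using is_starI[OF F ne, of y] nonstar by blast
  then obtain e where e: "e \<in> edges F" "y \<notin> e" by blast
  define d where "d = num_edges F - 1"
  have ey: "e \<noteq> {y, z}" using e by blast
  have ge: "2 \<le> num_edges F"
    using card_mono[OF E(1), of "{e, {y, z}}"] e yz ey by (simp add: num_edges_def)
  \<comment> \<open>The edge \<open>e\<close> avoids \<open>y\<close> by choice and \<open>z\<close>
    because \<open>z\<close> is a leaf, so two edges would form the excluded matching. This gives
    the bound \<open>2 \<le> d\<close> that the gadget needs.\<close>
  have "num_edges F \<noteq> 2"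
  proof
    assume 2: "num_edges F = 2"
    have "{e, {y, z}} = edges F"
      by (rule card_subset_eq[OF E(1)]) (use e yz ey 2 in \<open>auto simp: num_edges_def\<close>)
    moreover have "e \<inter> {y, z} = {}" using e yz ey by blast
    ultimately have "is_matching F" unfolding is_matching_def by (metis Int_commute empty_iff insert_iff)
    then show False using nonmatching 2 by blast
  qed
  then have d: "2 \<le> d" "card (edges F) = Suc d" using ge by (auto simp: d_def num_edges_def)
  obtain V0 :: "(bool + nat \<times> (nat list \<Rightarrow> nat list)) set" and E0 where
    V0: "finite V0" "V0 \<noteq> {}" and E0: "\<forall>e\<in>E0. e \<subseteq> V0 \<and> card e = 2" "\<forall>a\<in>V0. card {e\<in>E0. a \<in> e} = d"
    and sp0: "sparse (Suc d) E0" and differ: "\<forall>c :: _ \<Rightarrow> nat. proper_edge_colouring (V0, E0) c \<longrightarrow>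
       (\<exists>a b. {a, b} \<in> E0 \<and> colours_at E0 c a \<noteq> colours_at E0 c b)"
    \<comment> \<open>\<open>Suc d\<close> is the number of edges of \<open>F\<close>, so sparsity
      covers the image of any component.\<close>
    by (rule class_two_graph_exists[OF d(1), of "Suc d"])
  \<comment> \<open>The copies are indexed by the components of \<open>F\<close>; an isolated vertex
    is a component of its own.\<close>
  define I where "I = reach (edges F) ` verts F"
  let ?G = "(I \<times> V0, copies_edges I E0)"
  have G: "\<forall>e\<in>copies_edges I E0. e \<subseteq> I \<times> V0 \<and> card e = 2" using E0(1) by (rule copies_simple)
  have "finite I" using F by (simp add: I_def simple_graph_def)
  then have sG: "simple_graph ?G" using G V0(1) by (simp add: simple_graph_def)
  have deg: "max_degree_le ?G d"
    unfolding max_degree_le_def degree_def using E0(2) by (auto simp: copies_degree)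
  have "has_rainbow_copy F ?G c" if c: "proper_edge_colouring ?G c" for c :: "_ \<Rightarrow> nat"
  proof -
    have "\<exists>f. rainbow_hom (edges F) (copies_edges I E0) c f \<and>
        (\<forall>v\<in>verts F. f v \<in> I \<times> V0 \<and> fst (f v) = reach (edges F) v)"
      by (rule forest_rainbow_hom[OF E(1,2) _ E(3) d(2) yz ex V0(2) E0 differ I_def c]) (rule sp)
    then obtain f where f: "rainbow_hom (edges F) (copies_edges I E0) c f"
      "\<forall>v\<in>verts F. f v \<in> I \<times> V0 \<and> fst (f v) = reach (edges F) v" by blast
    have "inj_on f (verts F)"
      by (rule rainbow_hom_inj[OF E(1,2) sp0 _ f(1)]) (use d f(2) in auto)
    then show ?thesis
      unfolding has_rainbow_copy_iff[OF F] using f by (intro exI[of _ f]) auto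
  qed
  then have "forces_rainbow F d ?G" using sG deg by (simp add: forces_rainbow_def)
  then show ?thesis
    using AR_d_eqI[OF F] forces_rainbow_lower_bound[OF F] unfolding d_def by blast
qed

theorem theorem1p3:
  fixes F :: "'a ugraph"
  assumes "forest F"
  shows "AR_d F =
    (if is_star (delete_isolated F) \<or> (is_matching F \<and> num_edges F = 2)
     then num_edges F else num_edges F - 1)"
proof -
  have F: "simple_graph F" using assms by (simp add: forest_def)
  \<comment> \<open>For an edgeless \<open>F\<close> both branches are \<open>0\<close>, since
    subtraction on the naturals is truncated.\<close>
  show ?thesis
    using AR_d_star[OF F] AR_d_two_matching[OF F] AR_d_edgeless[OF F] AR_d_forest[OF assms]
    by (cases "edges F = {}") (auto simp: num_edges_def)
qed

end
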